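(* In the hybrid logic $\mathcal{H}_{\Sigma}(@_z)$ over a many-sorted signature $(S,\Sigma)$, every consistent set of formulas is satisfiable: if $s\in S$ and $\Gamma$ is a consistent set of formulas of sort $s$, then there exist an $(S,\Sigma)$-model $\mathcal{M}=(W,(R_\sigma)_{\sigma\in\Sigma},V)$, an assignment $g$ and a world $w\in W_s$ such that $\mathcal{M},g,w\models_s\phi$ for all $\phi\in\Gamma$.
   Context: A many-sorted signature $(S,\Sigma)$ consists of a set $S$ of sorts and operation symbols $\sigma:s_1\cdots s_n\to s$; $\Sigma_{s_1\cdots s_n,s}$ is the set of symbols of that type. Fix countable $S$-sorted sets $\mathrm{PROP}$ (propositional variables, each $\mathrm{PROP}_s\neq\emptyset$), $\mathrm{NOM}$ (nominals), $\mathrm{SVAR}$ (state variables), pairwise disjoint. A state symbol of sort $s$ is an element of $\mathrm{NOM}_s\cup\mathrm{SVAR}_s$. Formulas of sort $s$: $\phi_s ::= p\mid j\mid x\mid \neg\phi_s\mid \phi_s\vee\phi_s\mid \sigma(\phi_{s_1},\ldots,\phi_{s_n})\mid @^s_z\psi$, with $p\in\mathrm{PROP}_s$, $j\in\mathrm{NOM}_s$, $x\in\mathrm{SVAR}_s$, $\sigma\in\Sigma_{s_1\cdots s_n,s}$, and $z$ a state symbol of some sort $t$, $\psi$ of sort $t$ (for every $s$, $@^s_z\psi$ has sort $s$). Usual derived connectives; $\sigma^{\Box}(\phi_1,\ldots,\phi_n):=\neg\sigma(\neg\phi_1,\ldots,\neg\phi_n)$. Semantics: a model $\mathcal{M}=(W,(R_\sigma),V)$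 has nonempty sets $W_s$, relations $R_\sigma\subseteq W_s\times W_{s_1}\times\cdots\times W_{s_n}$ for $\sigma\in\Sigma_{s_1\cdots s_n,s}$, and $V_s:\mathrm{PROP}_s\cup\mathrm{NOM}_s\to\mathcal{P}(W_s)$ with $V_s(j)$ a singleton for nominals $j$. An assignment is $g=\{g_s\}$, $g_s:\mathrm{SVAR}_s\to W_s$; $Den_g(z)$ is the element of $V(z)$ for a nominal $z$ and $g(z)$ for a state variable $z$. For $w\in W_s$: $p$ holds iff $w\in V_s(p)$; $j$ iff $w\in V_s(j)$; $x$ iff $w=g_s(x)$; $\neg,\vee$ as usual; $\sigma(\phi_1,\ldots,\phi_n)$ iff there are $w_i\in W_{s_i}$ with $R_\sigma ww_1\cdots w_n$ and $\mathcal{M},g,w_i\models_{s_i}\phi_i$ for all $i$; $@^s_z\psi$ iff $\mathcal{M},g,Den_g(z)\models_t\psi$. Theorems $\vdash_s\phi$: the least family containing the axioms and closed under the rules. Axioms: instances at each sort of propositional tautologies; $(K_\sigma)$ $\sigma^\Box(\ldots,\phi\to\chi,\ldots)\to(\sigma^\Box(\ldots,\phi,\ldots)\to\sigma^\Box(\ldots,\chi,\ldots))$; $(Dual_\sigma)$ $\sigma(\psi_1,\ldots,\psi_n)\leftrightarrow\neg\sigma^\Box(\neg\psi_1,\ldots,\neg\psi_n)$; $(K@)$ $@^s_z(\phi\to\psi)\to(@^s_z\phi\to @^s_z\psi)$; $(SelfDual)$ $@^s_z\phi\leftrightarrow\neg @^s_z\neg\phi$; $(Intro)$ $z\to(\phi\leftrightarrow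 @^s_z\phi)$ ($z,\phi$ of sort $s$); $(Agree)$ $@^t_y @^{t'}_z\phi\leftrightarrow @^t_z\phi$ ($y$ of sort $t'$; $z,\phi$ of a common sort); $(Ref)$ $@^s_z z$; $(Back)$ $\sigma(\phi_1,\ldots,@^{s_i}_z\psi,\ldots,\phi_n)\to @^s_z\psi$. Rules: Modus Ponens; (UG) from $\vdash_{s_i}\phi$ infer $\vdash_s\sigma^\Box(\phi_1,\ldots,\phi,\ldots,\phi_n)$; (BroadcastS) from $\vdash_s @^s_z\phi$ infer $\vdash_{s'}@^{s'}_z\phi$; (Gen@) from $\vdash_{s'}\phi$ infer $\vdash_s @^s_z\phi$ ($z,\phi$ of sort $s'$); (Paste0) from $\vdash_s @^s_z(y\wedge\phi)\to\psi$ infer $\vdash_s @^s_z\phi\to\psi$; (Paste1) from $\vdash_s @^s_z\sigma(\ldots,y\wedge\phi,\ldots)\to\psi$ infer $\vdash_s @^s_z\sigma(\ldots,\phi,\ldots)\to\psi$; in the Paste rules $y$ is a state symbol distinct from $z$ not occurring in $\phi$ or $\psi$. A set $\Gamma$ of formulas of sort $s$ is consistent if there are no $\phi_1,\ldots,\phi_n\in\Gamma$ with $\vdash_s\neg(\phi_1\wedge\cdots\wedge\phi_n)$. *)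

theory Defs
  imports "HOL-Library.Countable_Set"
begin

text \<open>The set \<open>S\<close> of sorts is the type \<open>'s\<close>. Every symbol occurring in a formula is
  labelled with its sort (operation symbols with their arity and sort), so neither an operation
  symbol of several types nor overlapping members of a sorted family lead to ambiguity.\<close>

record ('s, 'f, 'p, 'n, 'v) language =
  Ops :: "'s list \<Rightarrow> 's \<Rightarrow> 'f set"
  Props :: "'s \<Rightarrow> 'p set"
  Noms :: "'s \<Rightarrow> 'n set"
  SVars :: "'s \<Rightarrow> 'v set"

definition hybrid_language :: "('s, 'f, 'p, 'n, 'v) language \<Rightarrow> bool" where
  "hybrid_language L \<longleftrightarrow>
     (\<forall>s. countable (Props L s) \<and> Props L s \<noteq> {} \<and> countable (Noms L s) \<and> countable (SVars L s))"

datatype ('s, 'n, 'v) state_symbol = Nom 's 'n | SVar 's 'v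

primrec sort_of :: "('s, 'n, 'v) state_symbol \<Rightarrow> 's" where
  "sort_of (Nom s j) = s"
| "sort_of (SVar s x) = s"

definition state_symbols ::
  "('s, 'f, 'p, 'n, 'v) language \<Rightarrow> 's \<Rightarrow> ('s, 'n, 'v) state_symbol set" where
  "state_symbols L s = Nom s ` Noms L s \<union> SVar s ` SVars L s"

text \<open>\<open>App [s\<^sub>1, \<dots>, s\<^sub>n] s \<sigma> [\<phi>\<^sub>1, \<dots>, \<phi>\<^sub>n]\<close> is \<open>\<sigma>(\<phi>\<^sub>1, \<dots>, \<phi>\<^sub>n)\<close> for \<open>\<sigma> : s\<^sub>1 \<dots> s\<^sub>n \<rightarrow> s\<close>;
  \<open>At s z \<psi>\<close> is the formula \<open>@\<close> with superscript \<open>s\<close>, subscript \<open>z\<close> and argument \<open>\<psi>\<close>.\<close>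

datatype ('s, 'f, 'p, 'n, 'v) form =
  PVar 's 'p
| St "('s, 'n, 'v) state_symbol"
| Neg "('s, 'f, 'p, 'n, 'v) form"
| Or "('s, 'f, 'p, 'n, 'v) form" "('s, 'f, 'p, 'n, 'v) form"
| App "'s list" 's 'f "('s, 'f, 'p, 'n, 'v) form list"
| At 's "('s, 'n, 'v) state_symbol" "('s, 'f, 'p, 'n, 'v) form"

inductive wff :: "('s, 'f, 'p, 'n, 'v) language \<Rightarrow> 's \<Rightarrow> ('s, 'f, 'p, 'n, 'v) form \<Rightarrow> bool"
  for L where
  wff_PVar: "p \<in> Props L s \<Longrightarrow> wff L s (PVar s p)"
| wff_St: "z \<in> state_symbols L s \<Longrightarrow> wff L s (St z)"
| wff_Neg: "wff L s \<phi> \<Longrightarrow> wff L s (Neg \<phi>)"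
| wff_Or: "wff L s \<phi> \<Longrightarrow> wff L s \<psi> \<Longrightarrow> wff L s (Or \<phi> \<psi>)"
| wff_App: "\<sigma> \<in> Ops L ws s \<Longrightarrow> list_all2 (wff L) ws \<phi>s \<Longrightarrow> wff L s (App ws s \<sigma> \<phi>s)"
| wff_At: "z \<in> state_symbols L t \<Longrightarrow> wff L t \<psi> \<Longrightarrow> wff L s (At s z \<psi>)"

definition And ::
  "('s, 'f, 'p, 'n, 'v) form \<Rightarrow> ('s, 'f, 'p, 'n, 'v) form \<Rightarrow> ('s, 'f, 'p, 'n, 'v) form" where
  "And \<phi> \<psi> = Neg (Or (Neg \<phi>) (Neg \<psi>))"

definition Imp ::
  "('s, 'f, 'p, 'n, 'v) form \<Rightarrow> ('s, 'f, 'p, 'n, 'v) form \<Rightarrow> ('s, 'f, 'p, 'n, 'v) form" where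
  "Imp \<phi> \<psi> = Or (Neg \<phi>) \<psi>"

definition Iff ::
  "('s, 'f, 'p, 'n, 'v) form \<Rightarrow> ('s, 'f, 'p, 'n, 'v) form \<Rightarrow> ('s, 'f, 'p, 'n, 'v) form" where
  "Iff \<phi> \<psi> = And (Imp \<phi> \<psi>) (Imp \<psi> \<phi>)"

definition Box ::
  "'s list \<Rightarrow> 's \<Rightarrow> 'f \<Rightarrow> ('s, 'f, 'p, 'n, 'v) form list \<Rightarrow> ('s, 'f, 'p, 'n, 'v) form" where
  "Box ws s \<sigma> \<phi>s = Neg (App ws s \<sigma> (map Neg \<phi>s))"

fun occurring :: "('s, 'f, 'p, 'n, 'v) form \<Rightarrow> ('s, 'n, 'v) state_symbol set" where
  "occurring (PVar s p) = {}"
| "occurring (St z) = {z}"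
| "occurring (Neg \<phi>) = occurring \<phi>"
| "occurring (Or \<phi> \<psi>) = occurring \<phi> \<union> occurring \<psi>"
| "occurring (App ws s \<sigma> \<phi>s) = (\<Union>\<phi>\<in>set \<phi>s. occurring \<phi>)"
| "occurring (At s z \<psi>) = insert z (occurring \<psi>)"

record ('s, 'f, 'p, 'n, 'w) model =
  World :: "'s \<Rightarrow> 'w set"
  Rel :: "'s list \<Rightarrow> 's \<Rightarrow> 'f \<Rightarrow> ('w \<times> 'w list) set"
  ValP :: "'s \<Rightarrow> 'p \<Rightarrow> 'w set"
  ValN :: "'s \<Rightarrow> 'n \<Rightarrow> 'w set"

definition is_model ::
  "('s, 'f, 'p, 'n, 'v) language \<Rightarrow> ('s, 'f, 'p, 'n, 'w) model \<Rightarrow> bool" where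
  "is_model L M \<longleftrightarrow>
     (\<forall>s. World M s \<noteq> {}) \<and>
     (\<forall>ws s. \<forall>\<sigma>\<in>Ops L ws s. \<forall>(w, us)\<in>Rel M ws s \<sigma>.
        w \<in> World M s \<and> list_all2 (\<lambda>u t. u \<in> World M t) us ws) \<and>
     (\<forall>s. \<forall>p\<in>Props L s. ValP M s p \<subseteq> World M s) \<and>
     (\<forall>s. \<forall>j\<in>Noms L s. \<exists>w\<in>World M s. ValN M s j = {w})"

definition is_assignment ::
  "('s, 'f, 'p, 'n, 'v) language \<Rightarrow> ('s, 'f, 'p, 'n, 'w) model \<Rightarrow> ('s \<Rightarrow> 'v \<Rightarrow> 'w) \<Rightarrow> bool" where
  "is_assignment L M g \<longleftrightarrow> (\<forall>s. \<forall>x\<in>SVars L s. g s x \<in> World M s)"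

primrec Den ::
  "('s, 'f, 'p, 'n, 'w) model \<Rightarrow> ('s \<Rightarrow> 'v \<Rightarrow> 'w) \<Rightarrow> ('s, 'n, 'v) state_symbol \<Rightarrow> 'w" where
  "Den M g (Nom s j) = the_elem (ValN M s j)"
| "Den M g (SVar s x) = g s x"

fun sat ::
  "('s, 'f, 'p, 'n, 'w) model \<Rightarrow> ('s \<Rightarrow> 'v \<Rightarrow> 'w) \<Rightarrow> 'w \<Rightarrow> ('s, 'f, 'p, 'n, 'v) form \<Rightarrow> bool" where
  "sat M g w (PVar s p) \<longleftrightarrow> w \<in> ValP M s p"
| "sat M g w (St (Nom s j)) \<longleftrightarrow> w \<in> ValN M s j"
| "sat M g w (St (SVar s x)) \<longleftrightarrow> w = g s x"
| "sat M g w (Neg \<phi>) \<longleftrightarrow> \<not> sat M g w \<phi>"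
| "sat M g w (Or \<phi> \<psi>) \<longleftrightarrow> sat M g w \<phi> \<or> sat M g w \<psi>"
| "sat M g w (App ws s \<sigma> \<phi>s) \<longleftrightarrow>
     (\<exists>us. list_all2 (\<lambda>u t. u \<in> World M t) us ws \<and> (w, us) \<in> Rel M ws s \<sigma> \<and>
           list_all2 (\<lambda>u \<phi>. sat M g u \<phi>) us \<phi>s)"
| "sat M g w (At s z \<psi>) \<longleftrightarrow> sat M g (Den M g z) \<psi>"

datatype prop_form = Atom nat | PNeg prop_form | POr prop_form prop_form

primrec prop_eval :: "(nat \<Rightarrow> bool) \<Rightarrow> prop_form \<Rightarrow> bool" where
  "prop_eval v (Atom i) \<longleftrightarrow> v i"
| "prop_eval v (PNeg a) \<longleftrightarrow> \<not> prop_eval v a"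
| "prop_eval v (POr a b) \<longleftrightarrow> prop_eval v a \<or> prop_eval v b"

definition tautology :: "prop_form \<Rightarrow> bool" where
  "tautology a \<longleftrightarrow> (\<forall>v. prop_eval v a)"

primrec prop_inst ::
  "(nat \<Rightarrow> ('s, 'f, 'p, 'n, 'v) form) \<Rightarrow> prop_form \<Rightarrow> ('s, 'f, 'p, 'n, 'v) form" where
  "prop_inst \<theta> (Atom i) = \<theta> i"
| "prop_inst \<theta> (PNeg a) = Neg (prop_inst \<theta> a)"
| "prop_inst \<theta> (POr a b) = Or (prop_inst \<theta> a) (prop_inst \<theta> b)"

text \<open>Raw axiom schemes. The sort conditions on an instance are exactly that it is a formula,
  which is required where axioms enter \<open>derivable\<close>.\<close>

inductive axiom :: "('s, 'f, 'p, 'n, 'v) form \<Rightarrow> bool" where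
  Taut: "tautology a \<Longrightarrow> axiom (prop_inst \<theta> a)"
| K: "axiom (Imp (Box ws s \<sigma> (ls @ Imp \<phi> \<chi> # rs))
        (Imp (Box ws s \<sigma> (ls @ \<phi> # rs)) (Box ws s \<sigma> (ls @ \<chi> # rs))))"
| Dual: "axiom (Iff (App ws s \<sigma> \<psi>s) (Neg (Box ws s \<sigma> (map Neg \<psi>s))))"
| KAt: "axiom (Imp (At s z (Imp \<phi> \<psi>)) (Imp (At s z \<phi>) (At s z \<psi>)))"
| SelfDual: "axiom (Iff (At s z \<phi>) (Neg (At s z (Neg \<phi>))))"
| Intro: "axiom (Imp (St z) (Iff \<phi> (At s z \<phi>)))"
| Agree: "axiom (Iff (At t y (At t' z \<phi>)) (At t z \<phi>))"
| Ref: "axiom (At s z (St z))"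
| Back: "axiom (Imp (App ws s \<sigma> (ls @ At t z \<psi> # rs)) (At s z \<psi>))"

text \<open>In \<open>Paste1\<close> the freshness of \<open>y\<close> concerns \<open>\<phi>\<close> and \<open>\<psi>\<close> only, not the side arguments
  \<open>ls\<close> and \<open>rs\<close>.\<close>

inductive derivable ::
  "('s, 'f, 'p, 'n, 'v) language \<Rightarrow> 's \<Rightarrow> ('s, 'f, 'p, 'n, 'v) form \<Rightarrow> bool"
  for L where
  Ax: "axiom \<phi> \<Longrightarrow> wff L s \<phi> \<Longrightarrow> derivable L s \<phi>"
| MP: "derivable L s (Imp \<phi> \<psi>) \<Longrightarrow> derivable L s \<phi> \<Longrightarrow> derivable L s \<psi>"
| UG: "derivable L (ws ! length ls) \<phi> \<Longrightarrow> wff L s (Box ws s \<sigma> (ls @ \<phi> # rs))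
      \<Longrightarrow> derivable L s (Box ws s \<sigma> (ls @ \<phi> # rs))"
| BroadcastS: "derivable L s (At s z \<phi>) \<Longrightarrow> derivable L s' (At s' z \<phi>)"
| GenAt: "derivable L s' \<phi> \<Longrightarrow> z \<in> state_symbols L s' \<Longrightarrow> derivable L s (At s z \<phi>)"
| Paste0: "derivable L s (Imp (At s z (And (St y) \<phi>)) \<psi>)
      \<Longrightarrow> y \<noteq> z \<Longrightarrow> y \<notin> occurring \<phi> \<Longrightarrow> y \<notin> occurring \<psi>
      \<Longrightarrow> derivable L s (Imp (At s z \<phi>) \<psi>)"
| Paste1: "derivable L s (Imp (At s z (App ws t \<sigma> (ls @ And (St y) \<phi> # rs))) \<psi>)
      \<Longrightarrow> y \<noteq> z \<Longrightarrow> y \<notin> occurring \<phi> \<Longrightarrow> y \<notin> occurring \<psi>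
      \<Longrightarrow> derivable L s (Imp (At s z (App ws t \<sigma> (ls @ \<phi> # rs))) \<psi>)"

text \<open>\<open>foldl And \<phi> \<phi>s\<close> is the conjunction of the nonempty list \<open>\<phi> # \<phi>s\<close>.\<close>

definition consistent ::
  "('s, 'f, 'p, 'n, 'v) language \<Rightarrow> 's \<Rightarrow> ('s, 'f, 'p, 'n, 'v) form set \<Rightarrow> bool" where
  "consistent L s \<Gamma> \<longleftrightarrow>
     \<not> (\<exists>\<phi> \<phi>s. set (\<phi> # \<phi>s) \<subseteq> \<Gamma> \<and> derivable L s (Neg (foldl And \<phi> \<phi>s)))"

end

theory Submission
  imports Defs
begin

text \<open>Extend \<open>\<Gamma>\<close> to a maximal consistent set \<open>\<Delta>\<close>, and let the worlds of sort \<open>t\<close> be all maximal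
  consistent sets of sort \<open>t\<close> that contain the same \<open>@\<close>-statements as \<open>\<Delta>\<close>; no fresh nominals are
  introduced. By Intro, each state symbol \<open>z\<close> lies in exactly one of them, namely in the set of all
  \<open>\<phi>\<close> such that \<open>@\<close> with subscript \<open>z\<close> and argument \<open>\<phi>\<close> belongs to \<open>\<Delta>\<close>; by Agree that set is a
  world; and by Back the canonical successors of a world are worlds. BroadcastS provides a world of
  every sort.\<close>

subsection \<open>Propositional reasoning\<close>

text \<open>Whether \<open>At t z \<psi>\<close> belongs to a world has to depend on
  \<open>z\<close> alone, since its truth does; this forces the restriction to a single class of
  sets that agree on @. Two obstacles shape the rest. An operator with several arguments needs all
  its successors at once: every list of formulas drawn from the chosen sets must give an
  \<open>App\<close> formula in the given world, so the coordinates cannot be chosen independently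
  of each other. And every sort needs a world, although consistency is assumed at sort
  \<open>s\<close> only; a refutation at another sort has to be carried back to \<open>s\<close>,
  which is possible for a single @-formula. Propositional reasoning is semantic throughout:
  \<open>bval\<close> treats each formula not built by \<open>Neg\<close> or \<open>Or\<close> as an
  atom, so that a valuation may give unrelated values to formulas such as \<open>App\<close> and
  \<open>At\<close> with related arguments. Everything modal enters through a derivable formula that
  the valuation is required to satisfy.\<close>

fun bval :: "(('s, 'f, 'p, 'n, 'v) form \<Rightarrow> bool) \<Rightarrow> ('s, 'f, 'p, 'n, 'v) form \<Rightarrow> bool" where
  "bval v (Neg \<phi>) \<longleftrightarrow> \<not> bval v \<phi>"
| "bval v (Or \<phi> \<psi>) \<longleftrightarrow> bval v \<phi> \<or> bval v \<psi>"
| "bval v (PVar s p) \<longleftrightarrow> v (PVar s p)"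
| "bval v (St z) \<longleftrightarrow> v (St z)"
| "bval v (App ws s \<sigma> \<phi>s) \<longleftrightarrow> v (App ws s \<sigma> \<phi>s)"
| "bval v (At s z \<psi>) \<longleftrightarrow> v (At s z \<psi>)"

lemma bval_connectives [simp]:
  "bval v (And \<phi> \<psi>) \<longleftrightarrow> bval v \<phi> \<and> bval v \<psi>"
  "bval v (Imp \<phi> \<psi>) \<longleftrightarrow> (bval v \<phi> \<longrightarrow> bval v \<psi>)"
  "bval v (Iff \<phi> \<psi>) \<longleftrightarrow> (bval v \<phi> \<longleftrightarrow> bval v \<psi>)"
  "bval v (Box ws s \<sigma> \<phi>s) \<longleftrightarrow> \<not> v (App ws s \<sigma> (map Neg \<phi>s))"
  by (auto simp: And_def Imp_def Iff_def Box_def)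

lemma bval_foldl_And:
  "bval v (foldl And \<phi> \<phi>s) \<longleftrightarrow> (\<forall>\<psi>\<in>set (\<phi> # \<phi>s). bval v \<psi>)"
  by (induction \<phi>s arbitrary: \<phi>) auto

fun atoms :: "('s, 'f, 'p, 'n, 'v) form \<Rightarrow> ('s, 'f, 'p, 'n, 'v) form set" where
  "atoms (Neg \<phi>) = atoms \<phi>"
| "atoms (Or \<phi> \<psi>) = atoms \<phi> \<union> atoms \<psi>"
| "atoms \<phi> = {\<phi>}"

fun skeleton ::
  "(('s, 'f, 'p, 'n, 'v) form \<Rightarrow> nat) \<Rightarrow> ('s, 'f, 'p, 'n, 'v) form \<Rightarrow> prop_form" where
  "skeleton e (Neg \<phi>) = PNeg (skeleton e \<phi>)"
| "skeleton e (Or \<phi> \<psi>) = POr (skeleton e \<phi>) (skeleton e \<psi>)"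
| "skeleton e \<phi> = Atom (e \<phi>)"

lemma finite_atoms: "finite (atoms \<phi>)"
  by (induction \<phi> rule: atoms.induct) auto

lemma prop_eval_skeleton: "prop_eval v (skeleton e \<phi>) \<longleftrightarrow> bval (\<lambda>\<psi>. v (e \<psi>)) \<phi>"
  by (induction \<phi> rule: atoms.induct) auto

lemma prop_inst_skeleton:
  "(\<forall>\<psi>\<in>atoms \<phi>. \<theta> (e \<psi>) = \<psi>) \<Longrightarrow> prop_inst \<theta> (skeleton e \<phi>) = \<phi>"
  by (induction \<phi> rule: atoms.induct) auto

text \<open>The axiom speaks of instances of templates with numbered atoms. A formula has finitely
  many maximal subformulas that are not Boolean compounds; numbering them injectively by
  \<open>e\<close> turns it into its own template, and the inverse numbering is the substitution
  that gives it back.\<close>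

lemma derivable_tautology:
  assumes "wff L s \<phi>" "\<And>v. bval v \<phi>"
  shows "derivable L s \<phi>"
proof -
  obtain e :: "('a, 'b, 'c, 'd, 'e) form \<Rightarrow> nat" where e: "inj_on e (atoms \<phi>)"
    using finite_imp_inj_to_nat_seg[OF finite_atoms] by metis
  have "prop_inst (inv_into (atoms \<phi>) e) (skeleton e \<phi>) = \<phi>"
    using e by (intro prop_inst_skeleton) auto
  moreover have "tautology (skeleton e \<phi>)"
    using assms(2) by (simp add: tautology_def prop_eval_skeleton)
  ultimately show ?thesis
    using axiom.Taut derivable.Ax assms(1) by metis
qed

\<comment> \<open>Well-formed formulas and propositional consequence in the calculus\<close>
inductive_simps wff_PVar_iff [simp]: "wff L s (PVar t p)"
inductive_simps wff_St_iff [simp]: "wff L s (St z)"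
inductive_simps wff_Neg_iff [simp]: "wff L s (Neg \<phi>)"
inductive_simps wff_Or_iff [simp]: "wff L s (Or \<phi> \<psi>)"
inductive_simps wff_App_iff [simp]: "wff L s (App ws t \<sigma> \<phi>s)"
inductive_simps wff_At_iff: "wff L s (At t z \<psi>)"

lemma wff_connectives [simp]:
  "wff L s (And \<phi> \<psi>) \<longleftrightarrow> wff L s \<phi> \<and> wff L s \<psi>"
  "wff L s (Imp \<phi> \<psi>) \<longleftrightarrow> wff L s \<phi> \<and> wff L s \<psi>"
  "wff L s (Iff \<phi> \<psi>) \<longleftrightarrow> wff L s \<phi> \<and> wff L s \<psi>"
  "wff L s (Box ws t \<sigma> \<phi>s) \<longleftrightarrow> wff L s (App ws t \<sigma> \<phi>s)"
  by (auto simp: And_def Imp_def Iff_def Box_def list_all2_map2)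

lemma state_symbols_sort: "z \<in> state_symbols L t \<Longrightarrow> sort_of z = t"
  by (auto simp: state_symbols_def)

text \<open>In \<open>wff_At\<close> the sort of \<open>z\<close> is a free premise variable. It is
  determined by \<open>z\<close>, so inversion becomes a condition without a quantifier that the
  simplifier can use.\<close>

lemma wff_At_simp [simp]:
  "wff L s (At t z \<psi>) \<longleftrightarrow> t = s \<and> z \<in> state_symbols L (sort_of z) \<and> wff L (sort_of z) \<psi>"
  unfolding wff_At_iff by (metis state_symbols_sort)

text \<open>Serves the rule \<open>Paste1\<close>, whose conclusion changes one argument of an
  operator.\<close>

lemma list_all2_replace:
  assumes "list_all2 P us (xs @ x # ys)" "\<And>u. P u x \<Longrightarrow> P u y"
  shows "list_all2 P us (xs @ y # ys)"
  using assms(1) by (induction xs arbitrary: us) (auto simp: list_all2_Cons2 assms(2))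

lemma derivable_wff: "derivable L s \<phi> \<Longrightarrow> wff L s \<phi>"
proof (induction rule: derivable.induct)
  case (GenAt s' \<phi> z s)
  then show ?case by (auto simp: wff_At_iff simp del: wff_At_simp)
next
  case (Paste1 s z ws t \<sigma> ls y \<phi> rs \<psi>)
  then have "list_all2 (wff L) ws (ls @ And (St y) \<phi> # rs)" by simp
  then have "list_all2 (wff L) ws (ls @ \<phi> # rs)"
    by (rule list_all2_replace) simp
  then show ?case using Paste1.IH by simp
qed auto

text \<open>Replaces explicit Hilbert-style derivations: a propositional step is justified by
  checking valuations.\<close>

lemma derivable_consequence:
  assumes "derivable L s \<phi>" "wff L s \<psi>" "\<And>v. bval v \<phi> \<Longrightarrow> bval v \<psi>"
  shows "derivable L s \<psi>"
proof -
  have "derivable L s (Imp \<phi> \<psi>)"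
    by (rule derivable_tautology) (use assms(2,3) derivable_wff[OF assms(1)] in auto)
  then show ?thesis using assms(1) by (rule derivable.MP)
qed

lemma derivable_And:
  assumes "derivable L s \<phi>" "derivable L s \<psi>"
  shows "derivable L s (And \<phi> \<psi>)"
proof -
  have "derivable L s (Imp \<phi> (Imp \<psi> (And \<phi> \<psi>)))"
    by (rule derivable_tautology) (use derivable_wff[OF assms(1)] derivable_wff[OF assms(2)] in auto)
  from derivable.MP[OF derivable.MP[OF this assms(1)] assms(2)] show ?thesis .
qed

lemma derivable_consequence2:
  assumes "derivable L s \<phi>" "derivable L s \<chi>" "wff L s \<psi>"
    and "\<And>v. bval v \<phi> \<Longrightarrow> bval v \<chi> \<Longrightarrow> bval v \<psi>"
  shows "derivable L s \<psi>"
  using derivable_consequence[OF derivable_And[OF assms(1,2)] assms(3)] assms(4) by simp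

text \<open>Truth in the model with a single world of each sort and full relations. Its soundness is needed
  because \<open>consistent\<close> only speaks of nonempty conjunctions: \<open>{}\<close> is consistent even if every formula
  is derivable.\<close>

fun trivial_truth :: "('s, 'f, 'p, 'n, 'v) form \<Rightarrow> bool" where
  "trivial_truth (PVar s p) \<longleftrightarrow> True"
| "trivial_truth (St z) \<longleftrightarrow> True"
| "trivial_truth (Neg \<phi>) \<longleftrightarrow> \<not> trivial_truth \<phi>"
| "trivial_truth (Or \<phi> \<psi>) \<longleftrightarrow> trivial_truth \<phi> \<or> trivial_truth \<psi>"
| "trivial_truth (App ws s \<sigma> \<phi>s) \<longleftrightarrow> (\<forall>\<phi>\<in>set \<phi>s. trivial_truth \<phi>)"
| "trivial_truth (At s z \<psi>) \<longleftrightarrow> trivial_truth \<psi>"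

lemma trivial_truth_connectives [simp]:
  "trivial_truth (And \<phi> \<psi>) \<longleftrightarrow> trivial_truth \<phi> \<and> trivial_truth \<psi>"
  "trivial_truth (Imp \<phi> \<psi>) \<longleftrightarrow> (trivial_truth \<phi> \<longrightarrow> trivial_truth \<psi>)"
  "trivial_truth (Iff \<phi> \<psi>) \<longleftrightarrow> (trivial_truth \<phi> \<longleftrightarrow> trivial_truth \<psi>)"
  "trivial_truth (Box ws s \<sigma> \<phi>s) \<longleftrightarrow> (\<exists>\<phi>\<in>set \<phi>s. trivial_truth \<phi>)"
  by (auto simp: And_def Imp_def Iff_def Box_def)

text \<open>Truth in the one-world model is itself a valuation of the atoms, hence a witness that no
  derivable formula is propositionally contradictory.\<close>

lemma bval_trivial_truth: "bval trivial_truth \<phi> \<longleftrightarrow> trivial_truth \<phi>"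
  by (induction \<phi> rule: atoms.induct) auto

lemma trivial_truth_prop_inst:
  "trivial_truth (prop_inst \<theta> a) \<longleftrightarrow> prop_eval (\<lambda>i. trivial_truth (\<theta> i)) a"
  by (induction a) auto

lemma axiom_trivial_truth: "axiom \<phi> \<Longrightarrow> trivial_truth \<phi>"
  by (induction rule: axiom.induct) (auto simp: trivial_truth_prop_inst tautology_def)

text \<open>A \<open>Box\<close> is true there as soon as one argument is, which covers
  \<open>UG\<close>; every state symbol is true, so \<open>And (St y) \<phi>\<close> has the truth
  value of \<open>\<phi>\<close>, which covers the Paste rules.\<close>

lemma derivable_trivial_truth: "derivable L s \<phi> \<Longrightarrow> trivial_truth \<phi>"
  by (induction rule: derivable.induct) (auto simp: axiom_trivial_truth)

subsection \<open>Maximal consistent sets\<close>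

text \<open>If no valuation satisfies both \<open>\<chi>\<close> and \<open>F\<close>, the negated
  conjunction of \<open>F\<close> follows propositionally from \<open>\<chi>\<close>. A single
  theorem \<open>\<chi>\<close> is enough because several can be conjoined.\<close>

lemma consistent_iff:
  assumes "\<forall>\<phi>\<in>X. wff L s \<phi>"
  shows "consistent L s X \<longleftrightarrow>
    (\<forall>F \<chi>. finite F \<longrightarrow> F \<subseteq> X \<longrightarrow> derivable L s \<chi> \<longrightarrow>
       (\<exists>v. bval v \<chi> \<and> (\<forall>\<phi>\<in>F. bval v \<phi>)))"
proof (intro iffI allI impI)
  fix F \<chi>
  assume cons: "consistent L s X" and F: "finite F" "F \<subseteq> X" and der: "derivable L s \<chi>"
  show "\<exists>v. bval v \<chi> \<and> (\<forall>\<phi>\<in>F. bval v \<phi>)"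
  proof (rule ccontr)
    assume none: "\<not> ?thesis"
    show False
    proof (cases "F = {}")
      case True
      \<comment> \<open>There is no conjunction to refute here; the valuation comes from the trivial
        model.\<close>
      then show False
        using none derivable_trivial_truth[OF der] bval_trivial_truth by blast
    next
      case False
      then obtain \<phi> \<phi>s where F_eq: "F = set (\<phi> # \<phi>s)"
        using finite_list[OF F(1)] by (metis list.exhaust list.set(1))
      have wf: "wff L s (foldl And \<psi> \<psi>s)" if "\<forall>\<chi>\<in>set (\<psi> # \<psi>s). wff L s \<chi>" for \<psi> \<psi>s
        using that by (induction \<psi>s arbitrary: \<psi>) auto
      have "derivable L s (Neg (foldl And \<phi> \<phi>s))"
        using none F assms wf[of \<phi> \<phi>s] unfolding F_eq
        by (intro derivable_consequence[OF der]) (auto simp: bval_foldl_And)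
      then show False
        using cons F(2) unfolding consistent_def F_eq by blast
    qed
  qed
next
  assume sem: "\<forall>F \<chi>. finite F \<longrightarrow> F \<subseteq> X \<longrightarrow> derivable L s \<chi> \<longrightarrow>
       (\<exists>v. bval v \<chi> \<and> (\<forall>\<phi>\<in>F. bval v \<phi>))"
  show "consistent L s X"
    unfolding consistent_def
  proof clarify
    fix \<phi> \<phi>s
    assume "set (\<phi> # \<phi>s) \<subseteq> X" "derivable L s (Neg (foldl And \<phi> \<phi>s))"
    then obtain v where "bval v (Neg (foldl And \<phi> \<phi>s))" "\<forall>\<psi>\<in>set (\<phi> # \<phi>s). bval v \<psi>"
      using sem finite_set by blast
    then show False
      by (simp add: bval_foldl_And)
  qed
qed

lemma consistent_satisfiable:
  assumes "consistent L s X" "\<forall>\<phi>\<in>X. wff L s \<phi>"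
    and "finite F" "F \<subseteq> X" "derivable L s \<chi>"
  shows "\<exists>v. bval v \<chi> \<and> (\<forall>\<phi>\<in>F. bval v \<phi>)"
  using assms(1) unfolding consistent_iff[OF assms(2)] using assms(3-5) by simp

lemma inconsistent_iff:
  assumes "\<forall>\<phi>\<in>X. wff L s \<phi>"
  shows "\<not> consistent L s X \<longleftrightarrow>
    (\<exists>F \<chi>. finite F \<and> F \<subseteq> X \<and> derivable L s \<chi> \<and>
       (\<forall>v. bval v \<chi> \<longrightarrow> (\<exists>\<phi>\<in>F. \<not> bval v \<phi>)))"
  unfolding consistent_iff[OF assms] by simp

definition mcs ::
  "('s, 'f, 'p, 'n, 'v) language \<Rightarrow> 's \<Rightarrow> ('s, 'f, 'p, 'n, 'v) form set \<Rightarrow> bool" where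
  "mcs L s \<Delta> \<longleftrightarrow> (\<forall>\<phi>\<in>\<Delta>. wff L s \<phi>) \<and> consistent L s \<Delta> \<and>
     (\<forall>\<phi>. wff L s \<phi> \<longrightarrow> \<phi> \<in> \<Delta> \<or> Neg \<phi> \<in> \<Delta>)"

lemma mcs_wff: "mcs L s \<Delta> \<Longrightarrow> \<phi> \<in> \<Delta> \<Longrightarrow> wff L s \<phi>"
  by (simp add: mcs_def)

text \<open>Zorn's lemma on the consistent supersets of \<open>X\<close>: an inconsistency uses
  finitely many formulas, so one in the union of a chain already occurs in a member of the
  chain.\<close>

lemma lindenbaum:
  assumes "\<forall>\<phi>\<in>X. wff L s \<phi>" "consistent L s X"
  obtains \<Delta> where "mcs L s \<Delta>" "X \<subseteq> \<Delta>"
proof -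
  let ?A = "{Y. X \<subseteq> Y \<and> (\<forall>\<phi>\<in>Y. wff L s \<phi>) \<and> consistent L s Y}"
  have chain: "\<Union>C \<in> ?A" if C: "C \<noteq> {}" "subset.chain ?A C" for C
  proof -
    have sub: "C \<subseteq> ?A" using C(2) by (simp add: subset.chain_def)
    then have wf: "\<forall>\<phi>\<in>\<Union>C. wff L s \<phi>" and X: "X \<subseteq> \<Union>C"
      using C(1) by auto
    have "consistent L s (\<Union>C)"
      unfolding consistent_def
    proof clarify
      fix \<phi> \<phi>s
      assume *: "set (\<phi> # \<phi>s) \<subseteq> \<Union>C" "derivable L s (Neg (foldl And \<phi> \<phi>s))"
      obtain Y where "Y \<in> C" "set (\<phi> # \<phi>s) \<subseteq> Y"
        using finite_subset_Union_chain[OF finite_set *(1) C] by blast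
      then show False
        using sub *(2) unfolding consistent_def by blast
    qed
    then show ?thesis using wf X by blast
  qed
  have "?A \<noteq> {}" using assms by blast
  then have "\<exists>M\<in>?A. \<forall>Y\<in>?A. M \<subseteq> Y \<longrightarrow> Y = M"
    using chain by (rule subset_Zorn_nonempty)
  then obtain \<Delta> where \<Delta>: "\<Delta> \<in> ?A" and max: "\<forall>Y\<in>?A. \<Delta> \<subseteq> Y \<longrightarrow> Y = \<Delta>"
    by (rule bexE)
  have wf: "\<forall>\<phi>\<in>\<Delta>. wff L s \<phi>" using \<Delta> by blast
  have "\<phi> \<in> \<Delta> \<or> Neg \<phi> \<in> \<Delta>" if "wff L s \<phi>" for \<phi>
  proof (rule ccontr)
    assume neither: "\<not> ?thesis"
    have "\<exists>F \<chi>. finite F \<and> F \<subseteq> insert \<psi> \<Delta> \<and> derivable L s \<chi> \<and>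
        (\<forall>v. bval v \<chi> \<longrightarrow> (\<exists>\<phi>\<in>F. \<not> bval v \<phi>))" if "wff L s \<psi>" "\<psi> \<notin> \<Delta>" for \<psi>
    proof -
      have "\<not> consistent L s (insert \<psi> \<Delta>)"
        using max that \<Delta> by blast
      moreover have wf': "\<forall>\<phi>\<in>insert \<psi> \<Delta>. wff L s \<phi>" using wf that by blast
      ultimately show ?thesis by (simp only: inconsistent_iff[OF wf'])
    qed
    from this[of \<phi>] this[of "Neg \<phi>"] that neither
    obtain F \<chi> F' \<chi>' where F: "finite F" "F \<subseteq> insert \<phi> \<Delta>" "derivable L s \<chi>"
        "\<forall>v. bval v \<chi> \<longrightarrow> (\<exists>\<phi>\<in>F. \<not> bval v \<phi>)"
      and F': "finite F'" "F' \<subseteq> insert (Neg \<phi>) \<Delta>" "derivable L s \<chi>'"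
        "\<forall>v. bval v \<chi>' \<longrightarrow> (\<exists>\<phi>\<in>F'. \<not> bval v \<phi>)"
      by auto
    \<comment> \<open>Without the added formulas, both refuted sets lie in \<open>\<Delta>\<close>.
      A valuation that satisfies what remains together with both theorems decides
      \<open>\<phi>\<close>, and so satisfies all of \<open>F\<close> or all of
      \<open>F'\<close>.\<close>
    have F'': "finite ((F - {\<phi>}) \<union> (F' - {Neg \<phi>}))" "(F - {\<phi>}) \<union> (F' - {Neg \<phi>}) \<subseteq> \<Delta>"
      using F F' by auto
    have "consistent L s \<Delta>" using \<Delta> by blast
    from consistent_satisfiable[OF this wf F'' derivable_And[OF F(3) F'(3)]]
    obtain v where v: "bval v (And \<chi> \<chi>')"
        "\<forall>\<psi>\<in>(F - {\<phi>}) \<union> (F' - {Neg \<phi>}). bval v \<psi>"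
      by (elim exE conjE)
    show False
    proof (cases "bval v \<phi>")
      case True
      then have "\<forall>\<psi>\<in>F. bval v \<psi>" using v(2) by blast
      then show False using v(1) F(4) by auto
    next
      case False
      then have "\<forall>\<psi>\<in>F'. bval v \<psi>" using v(2) by fastforce
      then show False using v(1) F'(4) by auto
    qed
  qed
  then have "mcs L s \<Delta>" using \<Delta> by (simp add: mcs_def)
  then show thesis using that \<Delta> by blast
qed

lemma mcs_closed:
  assumes "mcs L s \<Delta>" "finite F" "F \<subseteq> \<Delta>" "derivable L s \<chi>" "wff L s \<phi>"
    and "\<And>v. bval v \<chi> \<Longrightarrow> \<forall>\<psi>\<in>F. bval v \<psi> \<Longrightarrow> bval v \<phi>"
  shows "\<phi> \<in> \<Delta>"
proof (rule ccontr)
  assume "\<phi> \<notin> \<Delta>"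
  then have F: "finite (insert (Neg \<phi>) F)" "insert (Neg \<phi>) F \<subseteq> \<Delta>"
    using assms(1,2,3,5) by (auto simp: mcs_def)
  have "consistent L s \<Delta>" "\<forall>\<phi>\<in>\<Delta>. wff L s \<phi>" using assms(1) by (auto simp: mcs_def)
  from consistent_satisfiable[OF this F assms(4)] show False using assms(6) by auto
qed

lemma mcs_Neg:
  assumes "mcs L s \<Delta>" "wff L s \<phi>"
  shows "Neg \<phi> \<in> \<Delta> \<longleftrightarrow> \<phi> \<notin> \<Delta>"
proof
  assume neg: "Neg \<phi> \<in> \<Delta>"
  show "\<phi> \<notin> \<Delta>"
  proof
    assume "\<phi> \<in> \<Delta>"
    then have F: "finite {\<phi>, Neg \<phi>}" "{\<phi>, Neg \<phi>} \<subseteq> \<Delta>" using neg by auto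
    \<comment> \<open>Only a placeholder for the required theorem: the contradiction is purely
      propositional.\<close>
    have taut: "derivable L s (Imp \<phi> \<phi>)" using assms by (simp add: derivable_tautology)
    have "consistent L s \<Delta>" "\<forall>\<phi>\<in>\<Delta>. wff L s \<phi>" using assms(1) by (auto simp: mcs_def)
    from consistent_satisfiable[OF this F taut] show False by simp
  qed
qed (use assms in \<open>auto simp: mcs_def\<close>)

lemma mcs_Or:
  assumes "mcs L s \<Delta>" "wff L s \<phi>" "wff L s \<psi>"
  shows "Or \<phi> \<psi> \<in> \<Delta> \<longleftrightarrow> \<phi> \<in> \<Delta> \<or> \<psi> \<in> \<Delta>"
proof -
  have taut: "derivable L s (Imp \<phi> \<phi>)" using assms by (simp add: derivable_tautology)
  have "Or \<phi> \<psi> \<in> \<Delta>" if "\<phi> \<in> \<Delta>"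
    by (rule mcs_closed[OF assms(1) _ _ taut, of "{\<phi>}"]) (use that assms in auto)
  moreover have "Or \<phi> \<psi> \<in> \<Delta>" if "\<psi> \<in> \<Delta>"
    by (rule mcs_closed[OF assms(1) _ _ taut, of "{\<psi>}"]) (use that assms in auto)
  moreover have "\<psi> \<in> \<Delta>" if "Or \<phi> \<psi> \<in> \<Delta>" "\<phi> \<notin> \<Delta>"
    by (rule mcs_closed[OF assms(1) _ _ taut, of "{Or \<phi> \<psi>, Neg \<phi>}"])
      (use that assms mcs_Neg[OF assms(1,2)] in auto)
  ultimately show ?thesis by blast
qed

lemma mcs_connectives:
  assumes "mcs L s \<Delta>" "wff L s \<phi>" "wff L s \<psi>"
  shows "And \<phi> \<psi> \<in> \<Delta> \<longleftrightarrow> \<phi> \<in> \<Delta> \<and> \<psi> \<in> \<Delta>"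
    and "Imp \<phi> \<psi> \<in> \<Delta> \<longleftrightarrow> (\<phi> \<in> \<Delta> \<longrightarrow> \<psi> \<in> \<Delta>)"
    and "Iff \<phi> \<psi> \<in> \<Delta> \<longleftrightarrow> (\<phi> \<in> \<Delta> \<longleftrightarrow> \<psi> \<in> \<Delta>)"
  using assms by (auto simp: And_def Imp_def Iff_def mcs_Neg mcs_Or)

lemma mcs_derivable: "mcs L s \<Delta> \<Longrightarrow> derivable L s \<phi> \<Longrightarrow> \<phi> \<in> \<Delta>"
  by (rule mcs_closed[where F = "{}" and \<chi> = \<phi>]) (auto dest: derivable_wff)

lemma mcs_mp: "mcs L s \<Delta> \<Longrightarrow> derivable L s (Imp \<phi> \<psi>) \<Longrightarrow> \<phi> \<in> \<Delta> \<Longrightarrow> \<psi> \<in> \<Delta>"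
  using mcs_derivable mcs_connectives(2) derivable_wff wff_connectives(2) by metis

text \<open>Every finite conjunction collapses to one member, so consistency is checked one formula
  at a time. The sets built below are all closed under conjunction for this purpose.\<close>

lemma consistent_if_And_closed:
  assumes "\<And>\<phi> \<psi>. \<phi> \<in> X \<Longrightarrow> \<psi> \<in> X \<Longrightarrow> And \<phi> \<psi> \<in> X"
    and "\<And>\<phi>. \<phi> \<in> X \<Longrightarrow> \<not> derivable L s (Neg \<phi>)"
  shows "consistent L s X"
proof -
  have "foldl And \<phi> \<phi>s \<in> X" if "set (\<phi> # \<phi>s) \<subseteq> X" for \<phi> \<phi>s
    using that assms(1) by (induction \<phi>s arbitrary: \<phi>) auto
  then show ?thesis
    unfolding consistent_def using assms(2) by blast
qed

subsection \<open>Operators\<close>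

lemma wff_App_update:
  assumes "wff L s (App ws s \<sigma> \<phi>s)" "wff L (ws ! k) \<phi>" "k < length \<phi>s"
  shows "wff L s (App ws s \<sigma> (\<phi>s[k := \<phi>]))"
  using assms by (auto simp: list_all2_conv_all_nth nth_list_update)

text \<open>The calculus splits argument lists as \<open>ls @ \<phi> # rs\<close>; list updates at
  position \<open>k\<close> suit arguments that proceed coordinate by coordinate.\<close>

lemma derivable_Box_update:
  assumes "derivable L (ws ! k) \<phi>" "wff L s (App ws s \<sigma> \<phi>s)" "k < length \<phi>s"
  shows "derivable L s (Box ws s \<sigma> (\<phi>s[k := \<phi>]))"
proof -
  have eq: "\<phi>s[k := \<phi>] = take k \<phi>s @ \<phi> # drop (Suc k) \<phi>s" and len: "length (take k \<phi>s) = k"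
    using assms(3) by (auto simp: upd_conv_take_nth_drop)
  have wf: "wff L s (Box ws s \<sigma> (\<phi>s[k := \<phi>]))"
    using wff_App_update[OF assms(2) derivable_wff[OF assms(1)] assms(3)] by simp
  show ?thesis
    unfolding eq by (rule derivable.UG) (use assms(1) len wf eq in simp_all)
qed

lemma derivable_K_update:
  assumes "wff L s (App ws s \<sigma> \<phi>s)" "wff L (ws ! k) \<phi>" "wff L (ws ! k) \<psi>" "k < length \<phi>s"
  shows "derivable L s (Imp (Box ws s \<sigma> (\<phi>s[k := Imp \<phi> \<psi>]))
     (Imp (Box ws s \<sigma> (\<phi>s[k := \<phi>])) (Box ws s \<sigma> (\<phi>s[k := \<psi>]))))"
proof -
  have eq: "\<phi>s[k := \<chi>] = take k \<phi>s @ \<chi> # drop (Suc k) \<phi>s" for \<chi>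
    using assms(4) by (auto simp: upd_conv_take_nth_drop)
  have "wff L s (App ws s \<sigma> (\<phi>s[k := \<chi>]))" if "wff L (ws ! k) \<chi>" for \<chi>
    using wff_App_update[OF assms(1) that assms(4)] .
  then have "wff L s (Imp (Box ws s \<sigma> (\<phi>s[k := Imp \<phi> \<psi>]))
     (Imp (Box ws s \<sigma> (\<phi>s[k := \<phi>])) (Box ws s \<sigma> (\<phi>s[k := \<psi>]))))"
    using assms by simp
  then show ?thesis
    unfolding eq by (rule derivable.Ax[OF axiom.K])
qed

lemma derivable_Dual_update:
  assumes "wff L s (App ws s \<sigma> \<phi>s)" "wff L (ws ! k) \<phi>" "k < length \<phi>s"
  shows "derivable L s (Iff (App ws s \<sigma> (\<phi>s[k := \<phi>]))
     (Neg (Box ws s \<sigma> ((map Neg \<phi>s)[k := Neg \<phi>]))))"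
proof -
  have "wff L s (Iff (App ws s \<sigma> (\<phi>s[k := \<phi>]))
     (Neg (Box ws s \<sigma> (map Neg (\<phi>s[k := \<phi>])))))"
    using wff_App_update[OF assms] by (simp add: list_all2_map2)
  then show ?thesis
    unfolding map_update[symmetric] by (rule derivable.Ax[OF axiom.Dual])
qed

lemma wff_App_map_Neg:
  "wff L s (App ws s \<sigma> \<phi>s) \<Longrightarrow> wff L s (App ws s \<sigma> (map Neg \<phi>s))"
  by (simp add: list_all2_map2)

text \<open>\<open>UG\<close> is applied to \<open>Neg \<phi>\<close> among negated side arguments.
  Unfolding \<open>Box\<close> would leave double negations inside the operator, so
  \<open>Dual\<close> is what leads back to the original arguments.\<close>

lemma derivable_App_Neg:
  assumes "derivable L (ws ! k) (Neg \<phi>)" "wff L s (App ws s \<sigma> \<phi>s)" "k < length \<phi>s"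
  shows "derivable L s (Neg (App ws s \<sigma> (\<phi>s[k := \<phi>])))"
proof -
  have \<phi>: "wff L (ws ! k) \<phi>" using derivable_wff[OF assms(1)] by simp
  have "derivable L s (Box ws s \<sigma> ((map Neg \<phi>s)[k := Neg \<phi>]))"
    by (rule derivable_Box_update) (use assms wff_App_map_Neg[of L s ws \<sigma> \<phi>s] in simp_all)
  from derivable_consequence2[OF this derivable_Dual_update[OF assms(2) \<phi> assms(3)]]
  show ?thesis
    using wff_App_update[OF assms(2) \<phi> assms(3)] by auto
qed

text \<open>The contrapositive implication goes under the box by \<open>UG\<close>, is distributed
  by \<open>K\<close>, and is then dualised at both ends.\<close>

lemma derivable_App_mono1:
  assumes "derivable L (ws ! k) (Imp \<phi> \<psi>)" "wff L s (App ws s \<sigma> \<phi>s)" "k < length \<phi>s"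
  shows "derivable L s (Imp (App ws s \<sigma> (\<phi>s[k := \<phi>])) (App ws s \<sigma> (\<phi>s[k := \<psi>])))"
proof -
  have wf: "wff L (ws ! k) \<phi>" "wff L (ws ! k) \<psi>" using derivable_wff[OF assms(1)] by auto
  let ?N = "map Neg \<phi>s"
  have N: "wff L s (App ws s \<sigma> ?N)" "k < length ?N" using assms wff_App_map_Neg[of L s ws \<sigma> \<phi>s] by simp_all
  have "derivable L (ws ! k) (Imp (Neg \<psi>) (Neg \<phi>))"
    by (rule derivable_consequence[OF assms(1)]) (use wf in auto)
  then have "derivable L s (Box ws s \<sigma> (?N[k := Imp (Neg \<psi>) (Neg \<phi>)]))"
    using N by (rule derivable_Box_update)
  moreover have "derivable L s (Imp (Box ws s \<sigma> (?N[k := Imp (Neg \<psi>) (Neg \<phi>)]))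
     (Imp (Box ws s \<sigma> (?N[k := Neg \<psi>])) (Box ws s \<sigma> (?N[k := Neg \<phi>]))))"
    using N wf by (intro derivable_K_update) auto
  ultimately have "derivable L s
      (Imp (Box ws s \<sigma> (?N[k := Neg \<psi>])) (Box ws s \<sigma> (?N[k := Neg \<phi>])))"
    by (rule derivable.MP[rotated])
  from derivable_And[OF this derivable_And[OF
    derivable_Dual_update[OF assms(2) wf(1) assms(3)]
    derivable_Dual_update[OF assms(2) wf(2) assms(3)]]]
  show ?thesis
    by (rule derivable_consequence)
      (use wff_App_update[OF assms(2) _ assms(3)] wf in \<open>simp del: wff_App_iff\<close>, auto)
qed

text \<open>Applying \<open>K\<close> twice to the boxed tautology that \<open>Neg \<phi>\<close>
  and \<open>Neg \<psi>\<close> imply \<open>Neg (Or \<phi> \<psi>)\<close> gives the dual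
  statement.\<close>

lemma derivable_App_Or:
  assumes "wff L s (App ws s \<sigma> \<phi>s)" "wff L (ws ! k) \<phi>" "wff L (ws ! k) \<psi>" "k < length \<phi>s"
  shows "derivable L s (Imp (App ws s \<sigma> (\<phi>s[k := Or \<phi> \<psi>]))
     (Or (App ws s \<sigma> (\<phi>s[k := \<phi>])) (App ws s \<sigma> (\<phi>s[k := \<psi>]))))"
proof -
  let ?N = "map Neg \<phi>s"
  have N: "wff L s (App ws s \<sigma> ?N)" "k < length ?N" using assms wff_App_map_Neg[of L s ws \<sigma> \<phi>s] by simp_all
  have or: "wff L (ws ! k) (Or \<phi> \<psi>)" using assms by simp
  let ?i = "Imp (Neg \<psi>) (Neg (Or \<phi> \<psi>))"
  have "derivable L (ws ! k) (Imp (Neg \<phi>) ?i)"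
    using assms by (intro derivable_tautology) auto
  then have "derivable L s (Box ws s \<sigma> (?N[k := Imp (Neg \<phi>) ?i]))"
    using N by (rule derivable_Box_update)
  moreover have "derivable L s (Imp (Box ws s \<sigma> (?N[k := Imp (Neg \<phi>) ?i]))
     (Imp (Box ws s \<sigma> (?N[k := Neg \<phi>])) (Box ws s \<sigma> (?N[k := ?i]))))"
    using N assms by (intro derivable_K_update) auto
  ultimately have 1: "derivable L s
      (Imp (Box ws s \<sigma> (?N[k := Neg \<phi>])) (Box ws s \<sigma> (?N[k := ?i])))"
    by (rule derivable.MP[rotated])
  have 2: "derivable L s (Imp (Box ws s \<sigma> (?N[k := ?i]))
     (Imp (Box ws s \<sigma> (?N[k := Neg \<psi>])) (Box ws s \<sigma> (?N[k := Neg (Or \<phi> \<psi>)]))))"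
    using N assms by (intro derivable_K_update) auto
  from derivable_And[OF derivable_And[OF 1 2] derivable_And[OF
    derivable_Dual_update[OF assms(1) or assms(4)] derivable_And[OF
    derivable_Dual_update[OF assms(1,2,4)]
    derivable_Dual_update[OF assms(1,3,4)]]]]
  show ?thesis
    by (rule derivable_consequence)
      (use wff_App_update[OF assms(1) _ assms(4)] assms in \<open>simp del: wff_App_iff\<close>, auto)
qed

text \<open>A chain of changes in one coordinate; in the n-th intermediate list the first n
  arguments are already replaced.\<close>

lemma derivable_App_mono:
  assumes "wff L s (App ws s \<sigma> \<phi>s)" "length \<psi>s = length \<phi>s"
    and "\<And>k. k < length \<phi>s \<Longrightarrow> derivable L (ws ! k) (Imp (\<phi>s ! k) (\<psi>s ! k))"
  shows "derivable L s (Imp (App ws s \<sigma> \<phi>s) (App ws s \<sigma> \<psi>s))"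
proof -
  have "derivable L s (Imp (App ws s \<sigma> \<phi>s) (App ws s \<sigma> (take n \<psi>s @ drop n \<phi>s)))"
    if "n \<le> length \<phi>s" for n
    using that
  proof (induction n)
    case 0
    then show ?case using assms(1) by (intro derivable_tautology) auto
  next
    case (Suc n)
    let ?\<chi>s = "take n \<psi>s @ drop n \<phi>s"
    have IH: "derivable L s (Imp (App ws s \<sigma> \<phi>s) (App ws s \<sigma> ?\<chi>s))" using Suc by simp
    then have wf: "wff L s (App ws s \<sigma> ?\<chi>s)" using derivable_wff by fastforce
    have eq: "?\<chi>s[n := \<phi>s ! n] = ?\<chi>s" "?\<chi>s[n := \<psi>s ! n] = take (Suc n) \<psi>s @ drop (Suc n) \<phi>s"
      using Suc.prems assms(2)
      by (auto intro!: nth_equalityI simp: nth_append nth_list_update less_Suc_eq)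
    have "derivable L s (Imp (App ws s \<sigma> (?\<chi>s[n := \<phi>s ! n])) (App ws s \<sigma> (?\<chi>s[n := \<psi>s ! n])))"
      using Suc.prems assms(2) by (intro derivable_App_mono1[OF assms(3) wf]) auto
    then have step: "derivable L s (Imp (App ws s \<sigma> ?\<chi>s)
        (App ws s \<sigma> (take (Suc n) \<psi>s @ drop (Suc n) \<phi>s)))"
      unfolding eq .
    show ?case
      by (rule derivable_consequence2[OF IH step])
        (use assms(1) derivable_wff[OF step] in \<open>simp_all del: wff_App_iff\<close>)
  qed
  from this[of "length \<phi>s"] show ?thesis using assms(2) by simp
qed

text \<open>The successor sets are made maximal one coordinate at a time; the coordinates not yet treated
  remain merely directed.\<close>

definition directed ::
  "('s, 'f, 'p, 'n, 'v) language \<Rightarrow> 's \<Rightarrow> ('s, 'f, 'p, 'n, 'v) form set \<Rightarrow> bool" where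
  "directed L s A \<longleftrightarrow> (\<forall>\<phi>\<in>A. wff L s \<phi>) \<and>
     (\<forall>\<phi>\<in>A. \<forall>\<psi>\<in>A. \<exists>\<chi>\<in>A. derivable L s (Imp \<chi> \<phi>) \<and> derivable L s (Imp \<chi> \<psi>))"

lemma directed_singleton: "wff L s \<phi> \<Longrightarrow> directed L s {\<phi>}"
  by (auto simp: directed_def intro!: derivable_tautology)

lemma mcs_directed:
  assumes "mcs L s \<Delta>"
  shows "directed L s \<Delta>"
  unfolding directed_def
proof (intro conjI ballI)
  fix \<phi> \<psi>
  assume "\<phi> \<in> \<Delta>" "\<psi> \<in> \<Delta>"
  moreover from this have "wff L s \<phi>" "wff L s \<psi>" using mcs_wff[OF assms] by auto
  ultimately show "\<exists>\<chi>\<in>\<Delta>. derivable L s (Imp \<chi> \<phi>) \<and> derivable L s (Imp \<chi> \<psi>)"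
    using mcs_connectives(1)[OF assms]
    by (intro bexI[of _ "And \<phi> \<psi>"]) (auto intro!: derivable_tautology)
qed (use mcs_wff[OF assms] in blast)

text \<open>A common lower bound can be chosen in each coordinate separately. It merges two lists of
  side arguments into one list that implies both.\<close>

lemma directed_lists:
  assumes "length As = length ws" "\<forall>i<length ws. directed L (ws ! i) (As ! i)"
    and "list_all2 (\<in>) \<phi>s As" "list_all2 (\<in>) \<psi>s As"
  shows "\<exists>\<chi>s. list_all2 (\<in>) \<chi>s As \<and> (\<forall>i<length ws.
    derivable L (ws ! i) (Imp (\<chi>s ! i) (\<phi>s ! i)) \<and>
    derivable L (ws ! i) (Imp (\<chi>s ! i) (\<psi>s ! i)))"
proof -
  have "\<exists>\<chi>. \<chi> \<in> As ! i \<and> derivable L (ws ! i) (Imp \<chi> (\<phi>s ! i)) \<and>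
      derivable L (ws ! i) (Imp \<chi> (\<psi>s ! i))" if "i < length ws" for i
  proof -
    have "\<phi>s ! i \<in> As ! i" "\<psi>s ! i \<in> As ! i"
      using assms that by (auto simp: list_all2_conv_all_nth)
    then show ?thesis
      using assms(2) that unfolding directed_def by blast
  qed
  then obtain c where c: "\<forall>i<length ws. c i \<in> As ! i \<and> derivable L (ws ! i) (Imp (c i) (\<phi>s ! i)) \<and>
      derivable L (ws ! i) (Imp (c i) (\<psi>s ! i))"
    by metis
  show ?thesis
    by (rule exI[of _ "map c [0..<length ws]"])
      (use c assms(1) in \<open>simp add: list_all2_conv_all_nth\<close>)
qed

text \<open>The prime-filter step of the existence lemma. \<open>P \<psi>\<close> says that
  \<open>\<psi>\<close> is admissible at place \<open>k\<close> whatever the side arguments. The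
  inadmissible formulas form an ideal: they are closed downwards by monotonicity and under
  \<open>Or\<close> because the other coordinates are directed. The set \<open>A\<close> is an
  ultrafilter that contains \<open>\<phi>\<close> and avoids this ideal.\<close>

lemma mcs_coordinate:
  assumes \<Delta>: "mcs L s \<Delta>" and \<sigma>: "\<sigma> \<in> Ops L ws s"
    and len: "length As = length ws" and k: "k < length ws"
    and dir: "\<forall>i<length ws. directed L (ws ! i) (As ! i)"
    and \<phi>s: "list_all2 (\<in>) \<phi>s As"
    and App: "\<And>\<psi>s. list_all2 (\<in>) \<psi>s As \<Longrightarrow> App ws s \<sigma> \<psi>s \<in> \<Delta>"
    and single: "As ! k = {\<phi>}"
  obtains A where "mcs L (ws ! k) A" "\<phi> \<in> A"
    "\<And>\<psi>s. list_all2 (\<in>) \<psi>s (As[k := A]) \<Longrightarrow> App ws s \<sigma> \<psi>s \<in> \<Delta>"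
proof -
  let ?t = "ws ! k"
  define P where "P \<psi> \<longleftrightarrow> (\<forall>\<psi>s. list_all2 (\<in>) \<psi>s As \<longrightarrow> App ws s \<sigma> (\<psi>s[k := \<psi>]) \<in> \<Delta>)" for \<psi>
  have len': "length \<psi>s = length ws" and wf': "wff L s (App ws s \<sigma> \<psi>s)"
    if "list_all2 (\<in>) \<psi>s As" for \<psi>s
    using that len \<sigma> dir by (auto simp: list_all2_conv_all_nth directed_def)
  have \<phi>: "wff L ?t \<phi>" using dir k single by (simp add: directed_def)
  have P\<phi>: "P \<phi>"
  proof -
    have "\<psi>s[k := \<phi>] = \<psi>s" if "list_all2 (\<in>) \<psi>s As" for \<psi>s
      using that single k len by (metis list_all2_conv_all_nth list_update_id singletonD)
    then show ?thesis using App by (simp add: P_def)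
  qed
  have P_mono: "P \<chi>" if "derivable L ?t (Imp \<psi> \<chi>)" "P \<psi>" for \<psi> \<chi>
    unfolding P_def
  proof (intro allI impI)
    fix \<psi>s assume \<psi>s: "list_all2 (\<in>) \<psi>s As"
    have "derivable L s (Imp (App ws s \<sigma> (\<psi>s[k := \<psi>])) (App ws s \<sigma> (\<psi>s[k := \<chi>])))"
      using derivable_App_mono1[OF that(1) wf'[OF \<psi>s]] len'[OF \<psi>s] k by simp
    then show "App ws s \<sigma> (\<psi>s[k := \<chi>]) \<in> \<Delta>"
      using mcs_mp[OF \<Delta>] that(2) \<psi>s by (auto simp: P_def)
  qed
  have P_Or: "P \<psi> \<or> P \<chi>" if or: "P (Or \<psi> \<chi>)" "wff L ?t \<psi>" "wff L ?t \<chi>" for \<psi> \<chi>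
  proof (rule ccontr)
    assume "\<not> ?thesis"
    then obtain \<psi>s \<chi>s where \<psi>s: "list_all2 (\<in>) \<psi>s As" "App ws s \<sigma> (\<psi>s[k := \<psi>]) \<notin> \<Delta>"
      and \<chi>s: "list_all2 (\<in>) \<chi>s As" "App ws s \<sigma> (\<chi>s[k := \<chi>]) \<notin> \<Delta>"
      unfolding P_def by blast
    \<comment> \<open>The failures for \<open>\<psi>\<close> and for \<open>\<chi>\<close> come with
      different side arguments. \<open>P\<close> applied to the common lower bound
      \<open>\<theta>s\<close> puts one disjunct into \<open>\<Delta>\<close>, and
      \<open>upd\<close> moves it back to the list on which it was assumed to fail.\<close>
    obtain \<theta>s where \<theta>s: "list_all2 (\<in>) \<theta>s As"
      "\<And>i. i < length ws \<Longrightarrow> derivable L (ws ! i) (Imp (\<theta>s ! i) (\<psi>s ! i))"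
      "\<And>i. i < length ws \<Longrightarrow> derivable L (ws ! i) (Imp (\<theta>s ! i) (\<chi>s ! i))"
      using directed_lists[OF len dir \<psi>s(1) \<chi>s(1)] by blast
    have upd: "App ws s \<sigma> (\<xi>s[k := \<xi>]) \<in> \<Delta>"
      if "list_all2 (\<in>) \<xi>s As" "wff L ?t \<xi>" "App ws s \<sigma> (\<theta>s[k := \<xi>]) \<in> \<Delta>"
        "\<And>i. i < length ws \<Longrightarrow> derivable L (ws ! i) (Imp (\<theta>s ! i) (\<xi>s ! i))" for \<xi>s \<xi>
    proof (rule mcs_mp[OF \<Delta> _ that(3)], rule derivable_App_mono)
      show "wff L s (App ws s \<sigma> (\<theta>s[k := \<xi>]))" using mcs_wff[OF \<Delta> that(3)] .
      show "length (\<xi>s[k := \<xi>]) = length (\<theta>s[k := \<xi>])" using len'[OF \<theta>s(1)] len'[OF that(1)] by simp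
      fix i assume "i < length (\<theta>s[k := \<xi>])"
      then have i: "i < length ws" using len'[OF \<theta>s(1)] by simp
      show "derivable L (ws ! i) (Imp (\<theta>s[k := \<xi>] ! i) (\<xi>s[k := \<xi>] ! i))"
        using that(2) that(4)[OF i] i len'[OF that(1)] len'[OF \<theta>s(1)]
        by (cases "i = k") (simp_all add: derivable_tautology)
    qed
    have "App ws s \<sigma> (\<theta>s[k := Or \<psi> \<chi>]) \<in> \<Delta>" using or(1) \<theta>s(1) by (simp add: P_def)
    moreover have "derivable L s (Imp (App ws s \<sigma> (\<theta>s[k := Or \<psi> \<chi>]))
       (Or (App ws s \<sigma> (\<theta>s[k := \<psi>])) (App ws s \<sigma> (\<theta>s[k := \<chi>]))))"
      using derivable_App_Or[OF wf'[OF \<theta>s(1)] or(2,3)] k len'[OF \<theta>s(1)] by simp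
    ultimately have "Or (App ws s \<sigma> (\<theta>s[k := \<psi>])) (App ws s \<sigma> (\<theta>s[k := \<chi>])) \<in> \<Delta>"
      using mcs_mp[OF \<Delta>] by blast
    moreover have "wff L s (App ws s \<sigma> (\<theta>s[k := \<psi>]))" "wff L s (App ws s \<sigma> (\<theta>s[k := \<chi>]))"
      using wff_App_update[OF wf'[OF \<theta>s(1)]] or(2,3) k len'[OF \<theta>s(1)] by auto
    ultimately have "App ws s \<sigma> (\<theta>s[k := \<psi>]) \<in> \<Delta> \<or> App ws s \<sigma> (\<theta>s[k := \<chi>]) \<in> \<Delta>"
      using mcs_Or[OF \<Delta>] by blast
    then show False
      using upd[OF \<psi>s(1) or(2)] upd[OF \<chi>s(1) or(3)] \<psi>s(2) \<chi>s(2) \<theta>s by blast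
  qed
  have not_P: "\<not> P \<psi>" if "derivable L ?t (Neg \<psi>)" for \<psi>
  proof
    assume "P \<psi>"
    then have in\<Delta>: "App ws s \<sigma> (\<phi>s[k := \<psi>]) \<in> \<Delta>" using \<phi>s by (simp add: P_def)
    have "derivable L s (Neg (App ws s \<sigma> (\<phi>s[k := \<psi>])))"
      using derivable_App_Neg[OF that wf'[OF \<phi>s]] k len'[OF \<phi>s] by simp
    then show False
      using in\<Delta> mcs_derivable[OF \<Delta>] mcs_Neg[OF \<Delta> mcs_wff[OF \<Delta> in\<Delta>]] by blast
  qed
  \<comment> \<open>The formulas that \<open>A\<close> is forced to contain: those whose negation
    cannot hold together with \<open>\<phi>\<close> at place \<open>k\<close>. Since
    \<open>P_Or\<close> splits a failure of a conjunction, the set is closed under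
    \<open>And\<close>.\<close>
  let ?X = "{\<psi>. wff L ?t \<psi> \<and> \<not> P (And \<phi> (Neg \<psi>))}"
  have "consistent L ?t ?X"
  proof (rule consistent_if_And_closed)
    fix \<psi> \<chi> assume *: "\<psi> \<in> ?X" "\<chi> \<in> ?X"
    have "derivable L ?t (Imp (And \<phi> (Neg (And \<psi> \<chi>))) (Or (And \<phi> (Neg \<psi>)) (And \<phi> (Neg \<chi>))))"
      using * \<phi> by (intro derivable_tautology) auto
    then have "\<not> P (And \<phi> (Neg (And \<psi> \<chi>)))"
      using P_mono P_Or[of "And \<phi> (Neg \<psi>)" "And \<phi> (Neg \<chi>)"] * \<phi> by auto
    then show "And \<psi> \<chi> \<in> ?X" using * by simp
  next
    fix \<psi> assume \<psi>: "\<psi> \<in> ?X"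
    show "\<not> derivable L ?t (Neg \<psi>)"
    proof
      assume "derivable L ?t (Neg \<psi>)"
      then have "derivable L ?t (Imp \<phi> (And \<phi> (Neg \<psi>)))"
        by (rule derivable_consequence) (use \<phi> \<psi> in auto)
      then show False using P_mono P\<phi> \<psi> by blast
    qed
  qed
  then obtain A where A: "mcs L ?t A" "?X \<subseteq> A"
    using lindenbaum[of ?X L ?t] by blast
  have "derivable L ?t (Neg (And \<phi> (Neg \<phi>)))" using \<phi> by (intro derivable_tautology) auto
  then have \<phi>A: "\<phi> \<in> A" using not_P \<phi> A(2) by blast
  have PA: "P \<psi>" if "\<psi> \<in> A" for \<psi>
  proof (rule ccontr)
    assume "\<not> P \<psi>"
    have \<psi>: "wff L ?t \<psi>" using mcs_wff[OF A(1) that] .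
    then have "derivable L ?t (Imp (And \<phi> (Neg (Neg \<psi>))) \<psi>)"
      using \<phi> by (intro derivable_tautology) auto
    from P_mono[OF this] have "\<not> P (And \<phi> (Neg (Neg \<psi>)))" using \<open>\<not> P \<psi>\<close> by blast
    then have "Neg \<psi> \<in> A" using \<psi> A(2) by auto
    then show False using mcs_Neg[OF A(1) \<psi>] that by blast
  qed
  \<comment> \<open>Replacing the entry at \<open>k\<close> by \<open>\<phi>\<close> gives side
    arguments from \<open>As\<close>; admissibility of the original entry then puts it back.\<close>
  have "App ws s \<sigma> \<psi>s \<in> \<Delta>"
    if \<psi>s: "list_all2 (\<in>) \<psi>s (As[k := A])" for \<psi>s
  proof -
    have "list_all2 (\<in>) (\<psi>s[k := \<phi>]) As"
      using \<psi>s single k len by (auto simp: list_all2_conv_all_nth nth_list_update split: if_splits)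
    moreover have "\<psi>s ! k \<in> A" using \<psi>s k len by (auto simp: list_all2_conv_all_nth)
    ultimately have "App ws s \<sigma> (\<psi>s[k := \<phi>, k := \<psi>s ! k]) \<in> \<Delta>"
      using PA unfolding P_def by blast
    then show ?thesis by simp
  qed
  then show thesis by (rule that[OF A(1) \<phi>A])
qed

lemma mcs_successors:
  assumes \<Delta>: "mcs L s \<Delta>" and \<phi>s: "App ws s \<sigma> \<phi>s \<in> \<Delta>"
  obtains As where "list_all2 (mcs L) ws As" "list_all2 (\<in>) \<phi>s As"
    "\<And>\<psi>s. list_all2 (\<in>) \<psi>s As \<Longrightarrow> App ws s \<sigma> \<psi>s \<in> \<Delta>"
proof -
  have wf: "\<sigma> \<in> Ops L ws s" "list_all2 (wff L) ws \<phi>s" using mcs_wff[OF assms] by simp_all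
  have len: "length \<phi>s = length ws" using wf(2) by (simp add: list_all2_lengthD)
  \<comment> \<open>Invariant: the first \<open>k\<close> coordinates are maximal, the others still
    singletons. At the start the only available list is \<open>\<phi>s\<close> itself, so the last
    condition is the assumption on \<open>\<phi>s\<close>.\<close>
  have "\<exists>As. length As = length ws \<and> (\<forall>i<k. mcs L (ws ! i) (As ! i)) \<and>
      (\<forall>i<length ws. k \<le> i \<longrightarrow> As ! i = {\<phi>s ! i}) \<and> list_all2 (\<in>) \<phi>s As \<and>
      (\<forall>\<psi>s. list_all2 (\<in>) \<psi>s As \<longrightarrow> App ws s \<sigma> \<psi>s \<in> \<Delta>)" if "k \<le> length ws" for k
    using that
  proof (induction k)
    case 0
    have "\<psi>s = \<phi>s" if "list_all2 (\<in>) \<psi>s (map (\<lambda>\<phi>. {\<phi>}) \<phi>s)" for \<psi>s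
      by (rule nth_equalityI) (use that in \<open>auto simp: list_all2_conv_all_nth\<close>)
    then show ?case
      using len \<phi>s by (intro exI[of _ "map (\<lambda>\<phi>. {\<phi>}) \<phi>s"]) (auto simp: list_all2_conv_all_nth)
  next
    case (Suc k)
    then obtain As where As: "length As = length ws" "\<forall>i<k. mcs L (ws ! i) (As ! i)"
      "\<forall>i<length ws. k \<le> i \<longrightarrow> As ! i = {\<phi>s ! i}" "list_all2 (\<in>) \<phi>s As"
      "\<And>\<psi>s. list_all2 (\<in>) \<psi>s As \<Longrightarrow> App ws s \<sigma> \<psi>s \<in> \<Delta>"
      by auto
    have "directed L (ws ! i) (As ! i)" if "i < length ws" for i
      using As(2,3) that wf(2)
      by (cases "i < k") (auto simp: list_all2_conv_all_nth mcs_directed directed_singleton)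
    then have "\<forall>i<length ws. directed L (ws ! i) (As ! i)" by blast
    moreover have "k < length ws" using Suc.prems by simp
    moreover have "As ! k = {\<phi>s ! k}" using As(3) Suc.prems by simp
    ultimately obtain A where A: "mcs L (ws ! k) A" "\<phi>s ! k \<in> A"
      "\<And>\<psi>s. list_all2 (\<in>) \<psi>s (As[k := A]) \<Longrightarrow> App ws s \<sigma> \<psi>s \<in> \<Delta>"
      using mcs_coordinate[OF \<Delta> wf(1) As(1) _ _ As(4,5)] by metis
    show ?case
      by (rule exI[of _ "As[k := A]"])
        (use As A Suc.prems len in \<open>auto simp: list_all2_conv_all_nth nth_list_update less_Suc_eq\<close>)
  qed
  from this[of "length ws"] obtain As where As: "length As = length ws"
    "\<forall>i<length ws. mcs L (ws ! i) (As ! i)" "list_all2 (\<in>) \<phi>s As"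
    "\<forall>\<psi>s. list_all2 (\<in>) \<psi>s As \<longrightarrow> App ws s \<sigma> \<psi>s \<in> \<Delta>"
    by auto
  show thesis
    by (rule that[of As]) (use As in \<open>simp_all add: list_all2_conv_all_nth\<close>)
qed

subsection \<open>The satisfaction operators\<close>

lemma derivable_At_mono:
  assumes "derivable L t (Imp \<phi> \<psi>)" "z \<in> state_symbols L t"
  shows "derivable L s (Imp (At s z \<phi>) (At s z \<psi>))"
proof -
  have "derivable L s (Imp (At s z (Imp \<phi> \<psi>)) (Imp (At s z \<phi>) (At s z \<psi>)))"
    by (rule derivable.Ax[OF axiom.KAt])
      (use derivable_wff[OF assms(1)] assms(2) state_symbols_sort[OF assms(2)] in auto)
  then show ?thesis using derivable.GenAt[OF assms] by (rule derivable.MP)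
qed

lemma mcs_At_Neg:
  assumes "mcs L s \<Delta>" "z \<in> state_symbols L t" "wff L t \<phi>"
  shows "At s z (Neg \<phi>) \<in> \<Delta> \<longleftrightarrow> At s z \<phi> \<notin> \<Delta>"
proof -
  have wf: "wff L s (At s z \<phi>)" "wff L s (At s z (Neg \<phi>))"
    using assms(2,3) state_symbols_sort by fastforce+
  then have "derivable L s (Iff (At s z \<phi>) (Neg (At s z (Neg \<phi>))))"
    by (intro derivable.Ax[OF axiom.SelfDual]) simp
  then have "Iff (At s z \<phi>) (Neg (At s z (Neg \<phi>))) \<in> \<Delta>"
    using mcs_derivable[OF assms(1)] by blast
  then show ?thesis
    using wf by (simp add: mcs_connectives[OF assms(1)] mcs_Neg[OF assms(1)] del: wff_At_simp)
qed

definition named ::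
  "'s \<Rightarrow> ('s, 'f, 'p, 'n, 'v) form set \<Rightarrow> ('s, 'n, 'v) state_symbol \<Rightarrow> ('s, 'f, 'p, 'n, 'v) form set"
  where "named s \<Gamma> z = {\<phi>. At s z \<phi> \<in> \<Gamma>}"

lemma St_in_named:
  assumes "mcs L s \<Gamma>" "z \<in> state_symbols L t"
  shows "St z \<in> named s \<Gamma> z"
proof -
  have "derivable L s (At s z (St z))"
    by (rule derivable.Ax[OF axiom.Ref]) (use assms(2) state_symbols_sort in fastforce)
  then show ?thesis using mcs_derivable[OF assms(1)] by (simp add: named_def)
qed

text \<open>\<open>KAt\<close> gives closure under conjunction, and \<open>SelfDual\<close> gives
  completeness under negation. A refutable member would, by \<open>GenAt\<close>, put both an
  @-formula and its \<open>Neg\<close> version into \<open>\<Gamma>\<close>.\<close>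

lemma mcs_named:
  assumes \<Gamma>: "mcs L s \<Gamma>" and z: "z \<in> state_symbols L t"
  shows "mcs L t (named s \<Gamma> z)"
proof -
  have wf: "wff L t \<phi>" if "\<phi> \<in> named s \<Gamma> z" for \<phi>
    using mcs_wff[OF \<Gamma>] that state_symbols_sort[OF z] by (fastforce simp: named_def)
  have "consistent L t (named s \<Gamma> z)"
  proof (rule consistent_if_And_closed)
    fix \<phi> \<psi> assume *: "\<phi> \<in> named s \<Gamma> z" "\<psi> \<in> named s \<Gamma> z"
    then have wf': "wff L t \<phi>" "wff L t \<psi>" using wf by auto
    then have "derivable L t (Imp \<phi> (Imp \<psi> (And \<phi> \<psi>)))" by (intro derivable_tautology) auto
    then have "derivable L s (Imp (At s z \<phi>) (At s z (Imp \<psi> (And \<phi> \<psi>))))"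
      using z by (rule derivable_At_mono)
    then have "At s z (Imp \<psi> (And \<phi> \<psi>)) \<in> \<Gamma>" using mcs_mp[OF \<Gamma>] * by (simp add: named_def)
    moreover have "derivable L s (Imp (At s z (Imp \<psi> (And \<phi> \<psi>)))
        (Imp (At s z \<psi>) (At s z (And \<phi> \<psi>))))"
      by (rule derivable.Ax[OF axiom.KAt]) (use z wf' state_symbols_sort[OF z] in auto)
    ultimately have "Imp (At s z \<psi>) (At s z (And \<phi> \<psi>)) \<in> \<Gamma>" using mcs_mp[OF \<Gamma>] by blast
    then show "And \<phi> \<psi> \<in> named s \<Gamma> z"
      using * wf' z state_symbols_sort[OF z] by (simp add: mcs_connectives[OF \<Gamma>] named_def)
  next
    fix \<phi> assume \<phi>: "\<phi> \<in> named s \<Gamma> z"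
    show "\<not> derivable L t (Neg \<phi>)"
    proof
      assume "derivable L t (Neg \<phi>)"
      then have "derivable L s (At s z (Neg \<phi>))" using z by (rule derivable.GenAt)
      then have "At s z (Neg \<phi>) \<in> \<Gamma>" using mcs_derivable[OF \<Gamma>] by blast
      then show False using mcs_At_Neg[OF \<Gamma> z wf[OF \<phi>]] \<phi> by (simp add: named_def)
    qed
  qed
  then show ?thesis
    using wf mcs_At_Neg[OF \<Gamma> z] by (auto simp: mcs_def named_def)
qed

lemma mcs_Agree:
  assumes "mcs L s \<Delta>" "y \<in> state_symbols L t" "z \<in> state_symbols L t'" "wff L t' \<phi>"
  shows "At s y (At t z \<phi>) \<in> \<Delta> \<longleftrightarrow> At s z \<phi> \<in> \<Delta>"
proof -
  have wf: "wff L s (At s y (At t z \<phi>))" "wff L s (At s z \<phi>)"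
    using assms(2-4) state_symbols_sort[OF assms(2)] state_symbols_sort[OF assms(3)] by auto
  then have "derivable L s (Iff (At s y (At t z \<phi>)) (At s z \<phi>))"
    by (intro derivable.Ax[OF axiom.Agree]) simp
  then show ?thesis
    using mcs_derivable[OF assms(1)] mcs_connectives(3)[OF assms(1) wf] by blast
qed

lemma mcs_Intro:
  assumes "mcs L t \<Delta>" "z \<in> state_symbols L t" "St z \<in> \<Delta>" "wff L t \<phi>"
  shows "\<phi> \<in> \<Delta> \<longleftrightarrow> At t z \<phi> \<in> \<Delta>"
proof -
  have wf: "wff L t (At t z \<phi>)"
    using assms(2,4) state_symbols_sort[OF assms(2)] by auto
  then have "derivable L t (Imp (St z) (Iff \<phi> (At t z \<phi>)))"
    using assms by (intro derivable.Ax[OF axiom.Intro]) simp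
  then show ?thesis
    using mcs_mp[OF assms(1) _ assms(3)] mcs_connectives(3)[OF assms(1,4) wf] by blast
qed

subsection \<open>The canonical model\<close>

text \<open>The superscript must be the sort of the set in which the formula lies, so sets of
  different sorts are compared up to this superscript.\<close>

definition At_agree ::
  "('s, 'f, 'p, 'n, 'v) language \<Rightarrow> 's \<Rightarrow> ('s, 'f, 'p, 'n, 'v) form set \<Rightarrow>
   's \<Rightarrow> ('s, 'f, 'p, 'n, 'v) form set \<Rightarrow> bool" where
  "At_agree L s \<Gamma> t \<Delta> \<longleftrightarrow> (\<forall>u. \<forall>z\<in>state_symbols L u. \<forall>\<phi>. wff L u \<phi> \<longrightarrow>
     (At s z \<phi> \<in> \<Gamma> \<longleftrightarrow> At t z \<phi> \<in> \<Delta>))"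

text \<open>One inclusion suffices: by \<open>SelfDual\<close>, a missing @-formula is present with
  its argument negated, and the inclusion applies to that.\<close>

lemma At_agreeI:
  assumes "mcs L s \<Gamma>" "mcs L t \<Delta>"
    and "\<And>u z \<phi>. z \<in> state_symbols L u \<Longrightarrow> wff L u \<phi> \<Longrightarrow> At s z \<phi> \<in> \<Gamma> \<Longrightarrow> At t z \<phi> \<in> \<Delta>"
  shows "At_agree L s \<Gamma> t \<Delta>"
  unfolding At_agree_def
proof (intro allI ballI impI iffI)
  fix u z \<phi> assume z: "z \<in> state_symbols L u" "wff L u \<phi>" and At: "At t z \<phi> \<in> \<Delta>"
  show "At s z \<phi> \<in> \<Gamma>"
  proof (rule ccontr)
    assume "At s z \<phi> \<notin> \<Gamma>"
    then have "At s z (Neg \<phi>) \<in> \<Gamma>" using mcs_At_Neg[OF assms(1) z] by blast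
    then have "At t z (Neg \<phi>) \<in> \<Delta>" using assms(3) z by simp
    then show False using mcs_At_Neg[OF assms(2) z] At by blast
  qed
qed (use assms(3) in blast)

lemma At_agree_named:
  assumes "mcs L s \<Gamma>" "z \<in> state_symbols L t"
  shows "At_agree L s \<Gamma> t (named s \<Gamma> z)"
  using mcs_Agree[OF assms] by (auto simp: At_agree_def named_def)

lemma At_agree_exists:
  assumes \<Gamma>: "mcs L s \<Gamma>"
  shows "\<exists>\<Delta>. mcs L t \<Delta> \<and> At_agree L s \<Gamma> t \<Delta>"
proof (cases "\<exists>y u. y \<in> state_symbols L u")
  case False
  \<comment> \<open>Without any state symbols agreement is vacuous, so an arbitrary maximal
    consistent set of sort \<open>t\<close> will do.\<close>
  have "consistent L t {}" by (simp add: consistent_def)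
  then obtain \<Delta> where "mcs L t \<Delta>" using lindenbaum[of "{}" L t] by blast
  moreover have "At_agree L s \<Gamma> t \<Delta>" using False unfolding At_agree_def by blast
  ultimately show ?thesis by blast
next
  case True
  then obtain y u where y: "y \<in> state_symbols L u" by blast
  let ?Y = "named s \<Gamma> y"
  have Y: "mcs L u ?Y" using mcs_named[OF \<Gamma> y] .
  \<comment> \<open>A single symbol \<open>y\<close> carries all @-statements, since
    \<open>Agree\<close> absorbs an outer \<open>y\<close>. Keeping everything under one
    \<open>y\<close> reduces a refutation at sort \<open>t\<close> to one formula
    \<open>At t y (Neg \<psi>)\<close>, the form that \<open>BroadcastS\<close> can move to sort
    \<open>s\<close>.\<close>
  let ?X = "{\<phi>. \<exists>\<psi>\<in>?Y. derivable L t (Imp (At t y \<psi>) \<phi>)}"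
  have wf: "\<forall>\<phi>\<in>?X. wff L t \<phi>" using derivable_wff by fastforce
  have "consistent L t ?X"
  proof (rule consistent_if_And_closed)
    fix \<phi>1 \<phi>2 assume *: "\<phi>1 \<in> ?X" "\<phi>2 \<in> ?X"
    then obtain \<psi>1 \<psi>2 where \<psi>: "\<psi>1 \<in> ?Y" "derivable L t (Imp (At t y \<psi>1) \<phi>1)"
      "\<psi>2 \<in> ?Y" "derivable L t (Imp (At t y \<psi>2) \<phi>2)"
      by blast
    have wf\<psi>: "wff L u \<psi>1" "wff L u \<psi>2" using \<psi> mcs_wff[OF Y] by auto
    then have "And \<psi>1 \<psi>2 \<in> ?Y" using \<psi> mcs_connectives(1)[OF Y] by blast
    moreover have m: "derivable L t (Imp (At t y (And \<psi>1 \<psi>2)) (At t y \<psi>1))"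
      "derivable L t (Imp (At t y (And \<psi>1 \<psi>2)) (At t y \<psi>2))"
      by (rule derivable_At_mono[OF derivable_tautology y]; simp add: wf\<psi>)+
    have "derivable L t (Imp (At t y (And \<psi>1 \<psi>2)) (And \<phi>1 \<phi>2))"
      by (rule derivable_consequence2[OF derivable_And[OF \<psi>(2) \<psi>(4)] derivable_And[OF m]])
        (use wf * wf\<psi> y state_symbols_sort[OF y] in auto)
    ultimately show "And \<phi>1 \<phi>2 \<in> ?X" by blast
  next
    fix \<phi> assume "\<phi> \<in> ?X"
    then obtain \<psi> where \<psi>: "\<psi> \<in> ?Y" "derivable L t (Imp (At t y \<psi>) \<phi>)" by blast
    have wf\<psi>: "wff L u \<psi>" using \<psi> mcs_wff[OF Y] by auto
    show "\<not> derivable L t (Neg \<phi>)"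
    proof
      assume neg: "derivable L t (Neg \<phi>)"
      have dual: "derivable L t (Iff (At t y \<psi>) (Neg (At t y (Neg \<psi>))))"
        by (rule derivable.Ax[OF axiom.SelfDual]) (use wf\<psi> y state_symbols_sort[OF y] in auto)
      have "derivable L t (At t y (Neg \<psi>))"
        by (rule derivable_consequence2[OF derivable_And[OF neg \<psi>(2)] dual])
          (use wf\<psi> y state_symbols_sort[OF y] in auto)
      then have "derivable L s (At s y (Neg \<psi>))" by (rule derivable.BroadcastS)
      then have "At s y (Neg \<psi>) \<in> \<Gamma>" using mcs_derivable[OF \<Gamma>] by blast
      then show False using \<psi>(1) mcs_At_Neg[OF \<Gamma> y wf\<psi>] by (simp add: named_def)
    qed
  qed
  then obtain \<Delta> where \<Delta>: "mcs L t \<Delta>" "?X \<subseteq> \<Delta>" using lindenbaum[OF wf] by blast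
  have "At_agree L s \<Gamma> t \<Delta>"
  proof (rule At_agreeI[OF \<Gamma> \<Delta>(1)])
    fix v z \<phi> assume z: "z \<in> state_symbols L v" "wff L v \<phi>" "At s z \<phi> \<in> \<Gamma>"
    then have "At u z \<phi> \<in> ?Y" using mcs_Agree[OF \<Gamma> y] by (simp add: named_def)
    moreover have "derivable L t (Imp (At t y (At u z \<phi>)) (At t y (At u z \<phi>)))"
      using z y state_symbols_sort[OF z(1)] state_symbols_sort[OF y]
      by (intro derivable_tautology) auto
    ultimately have "At t y (At u z \<phi>) \<in> \<Delta>" using \<Delta>(2) by blast
    then show "At t z \<phi> \<in> \<Delta>" using mcs_Agree[OF \<Delta>(1) y z(1,2)] by blast
  qed
  then show ?thesis using \<Delta>(1) by blast
qed

definition canonical_world ::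
  "('s, 'f, 'p, 'n, 'v) language \<Rightarrow> 's \<Rightarrow> ('s, 'f, 'p, 'n, 'v) form set \<Rightarrow>
   's \<Rightarrow> ('s, 'f, 'p, 'n, 'v) form set set" where
  "canonical_world L s \<Gamma> t = {\<Delta>. mcs L t \<Delta> \<and> At_agree L s \<Gamma> t \<Delta>}"

text \<open>The relation is the usual canonical one for operators of several arguments, restricted
  to worlds. \<open>ValN\<close> does not mention membership of the nominal;
  \<open>canonical_St_iff\<close> reconciles the two.\<close>

definition canonical_model ::
  "('s, 'f, 'p, 'n, 'v) language \<Rightarrow> 's \<Rightarrow> ('s, 'f, 'p, 'n, 'v) form set \<Rightarrow>
   ('s, 'f, 'p, 'n, ('s, 'f, 'p, 'n, 'v) form set) model" where
  "canonical_model L s \<Gamma> = \<lparr>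
     World = canonical_world L s \<Gamma>,
     Rel = (\<lambda>ws t \<sigma>. {(\<Delta>, As). \<Delta> \<in> canonical_world L s \<Gamma> t \<and>
       list_all2 (\<lambda>A u. A \<in> canonical_world L s \<Gamma> u) As ws \<and>
       (\<forall>\<psi>s. list_all2 (\<in>) \<psi>s As \<longrightarrow> App ws t \<sigma> \<psi>s \<in> \<Delta>)}),
     ValP = (\<lambda>t p. {\<Delta> \<in> canonical_world L s \<Gamma> t. PVar t p \<in> \<Delta>}),
     ValN = (\<lambda>t j. {named s \<Gamma> (Nom t j)})\<rparr>"

definition canonical_assignment ::
  "'s \<Rightarrow> ('s, 'f, 'p, 'n, 'v) form set \<Rightarrow> 's \<Rightarrow> 'v \<Rightarrow> ('s, 'f, 'p, 'n, 'v) form set" where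
  "canonical_assignment s \<Gamma> t x = named s \<Gamma> (SVar t x)"

section \<open>The truth lemma and the model conditions\<close>

lemma named_in_canonical_world:
  "mcs L s \<Gamma> \<Longrightarrow> z \<in> state_symbols L t \<Longrightarrow> named s \<Gamma> z \<in> canonical_world L s \<Gamma> t"
  by (simp add: canonical_world_def mcs_named At_agree_named)

lemma Den_canonical:
  "Den (canonical_model L s \<Gamma>) (canonical_assignment s \<Gamma>) z = named s \<Gamma> z"
  by (cases z) (simp_all add: canonical_model_def canonical_assignment_def)

text \<open>If \<open>\<Delta>\<close> contains \<open>z\<close>, then \<open>Intro\<close> equates
  membership of \<open>\<phi>\<close> in \<open>\<Delta>\<close> with that of
  \<open>At t z \<phi>\<close>, and agreement moves the latter to \<open>\<Gamma>\<close>.\<close>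

lemma canonical_St_iff:
  assumes \<Gamma>: "mcs L s \<Gamma>" and z: "z \<in> state_symbols L t" and \<Delta>: "\<Delta> \<in> canonical_world L s \<Gamma> t"
  shows "St z \<in> \<Delta> \<longleftrightarrow> \<Delta> = named s \<Gamma> z"
proof
  assume St: "St z \<in> \<Delta>"
  have mcs: "mcs L t \<Delta>" "At_agree L s \<Gamma> t \<Delta>" using \<Delta> by (auto simp: canonical_world_def)
  have "\<phi> \<in> \<Delta> \<longleftrightarrow> \<phi> \<in> named s \<Gamma> z" if "wff L t \<phi>" for \<phi>
    using mcs_Intro[OF mcs(1) z St that] mcs(2) z that by (auto simp: At_agree_def named_def)
  then show "\<Delta> = named s \<Gamma> z"
    using mcs_wff[OF mcs(1)] mcs_wff[OF mcs_named[OF \<Gamma> z]] by blast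
qed (use St_in_named[OF \<Gamma> z] in simp)

lemma canonical_successors:
  assumes \<Delta>: "\<Delta> \<in> canonical_world L s \<Gamma> t" and App: "App ws t \<sigma> \<phi>s \<in> \<Delta>" and \<Gamma>: "mcs L s \<Gamma>"
  obtains As where "list_all2 (\<lambda>A u. A \<in> canonical_world L s \<Gamma> u) As ws" "list_all2 (\<in>) \<phi>s As"
    "\<And>\<psi>s. list_all2 (\<in>) \<psi>s As \<Longrightarrow> App ws t \<sigma> \<psi>s \<in> \<Delta>"
proof -
  have mcs: "mcs L t \<Delta>" "At_agree L s \<Gamma> t \<Delta>" using \<Delta> by (auto simp: canonical_world_def)
  obtain As where As: "list_all2 (mcs L) ws As" "list_all2 (\<in>) \<phi>s As"
    "\<And>\<psi>s. list_all2 (\<in>) \<psi>s As \<Longrightarrow> App ws t \<sigma> \<psi>s \<in> \<Delta>"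
    using mcs_successors[OF mcs(1) App] by blast
  have len: "length As = length ws" "length \<phi>s = length ws"
    using As(1,2) by (auto simp: list_all2_conv_all_nth)
  have "As ! i \<in> canonical_world L s \<Gamma> (ws ! i)" if i: "i < length ws" for i
  proof -
    have A: "mcs L (ws ! i) (As ! i)" using As(1) i by (simp add: list_all2_conv_all_nth)
    have "At_agree L (ws ! i) (As ! i) t \<Delta>"
    proof (rule At_agreeI[OF A mcs(1)])
      fix u z \<phi> assume z: "z \<in> state_symbols L u" "wff L u \<phi>" "At (ws ! i) z \<phi> \<in> As ! i"
      \<comment> \<open>An @-formula of the i-th successor may replace the i-th argument without
        leaving \<open>As\<close>, so the new \<open>App\<close> formula is still in
        \<open>\<Delta>\<close>; \<open>Back\<close> then extracts the @-formula.\<close>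
      let ?\<psi>s = "\<phi>s[i := At (ws ! i) z \<phi>]"
      have "list_all2 (\<in>) ?\<psi>s As"
        using As(2) z(3) i len by (auto simp: list_all2_conv_all_nth nth_list_update)
      then have in\<Delta>: "App ws t \<sigma> ?\<psi>s \<in> \<Delta>" by (rule As(3))
      have eq: "?\<psi>s = take i \<phi>s @ At (ws ! i) z \<phi> # drop (Suc i) \<phi>s"
        using i len by (simp add: upd_conv_take_nth_drop)
      have "wff L t (Imp (App ws t \<sigma> ?\<psi>s) (At t z \<phi>))"
        using mcs_wff[OF mcs(1) in\<Delta>] z state_symbols_sort[OF z(1)] by simp
      then have "derivable L t (Imp (App ws t \<sigma> ?\<psi>s) (At t z \<phi>))"
        unfolding eq by (rule derivable.Ax[OF axiom.Back])
      then show "At t z \<phi> \<in> \<Delta>" using mcs_mp[OF mcs(1)] in\<Delta> by blast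
    qed
    then have "At_agree L s \<Gamma> (ws ! i) (As ! i)" using mcs(2) by (simp add: At_agree_def)
    then show ?thesis using A by (simp add: canonical_world_def)
  qed
  then have "list_all2 (\<lambda>A u. A \<in> canonical_world L s \<Gamma> u) As ws"
    using len by (simp add: list_all2_conv_all_nth)
  then show thesis
    using As(2,3) by (rule that)
qed

lemma canonical_truth:
  assumes \<Gamma>: "mcs L s \<Gamma>" and "wff L t \<phi>" "\<Delta> \<in> canonical_world L s \<Gamma> t"
  shows "sat (canonical_model L s \<Gamma>) (canonical_assignment s \<Gamma>) \<Delta> \<phi> \<longleftrightarrow> \<phi> \<in> \<Delta>"
  using assms(2,3)
proof (induction arbitrary: \<Delta> rule: wff.induct)
  case (wff_PVar p t)
  then show ?case by (simp add: canonical_model_def)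
next
  case (wff_St z t)
  then show ?case
    using canonical_St_iff[OF \<Gamma>]
    by (cases z) (simp_all add: canonical_model_def canonical_assignment_def)
next
  case (wff_Neg t \<phi>)
  then show ?case by (auto simp: canonical_world_def mcs_Neg)
next
  case (wff_Or t \<phi> \<psi>)
  then show ?case by (auto simp: canonical_world_def mcs_Or)
next
  case (wff_App \<sigma> ws t \<phi>s)
  let ?sat = "sat (canonical_model L s \<Gamma>) (canonical_assignment s \<Gamma>)"
  have IH: "?sat (As ! i) (\<phi>s ! i) \<longleftrightarrow> \<phi>s ! i \<in> As ! i"
    if "list_all2 (\<lambda>A u. A \<in> canonical_world L s \<Gamma> u) As ws" "i < length ws" for As i
    using that wff_App.IH by (simp add: list_all2_conv_all_nth)
  have len: "length \<phi>s = length ws" using wff_App.IH by (simp add: list_all2_lengthD)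
  have iff: "list_all2 (\<lambda>A \<phi>. ?sat A \<phi>) As \<phi>s \<longleftrightarrow> list_all2 (\<in>) \<phi>s As"
    if "list_all2 (\<lambda>A u. A \<in> canonical_world L s \<Gamma> u) As ws" for As
    using IH[OF that] that len by (auto simp: list_all2_conv_all_nth)
  have "?sat \<Delta> (App ws t \<sigma> \<phi>s) \<longleftrightarrow>
      (\<exists>As. list_all2 (\<lambda>A u. A \<in> canonical_world L s \<Gamma> u) As ws \<and>
        (\<forall>\<psi>s. list_all2 (\<in>) \<psi>s As \<longrightarrow> App ws t \<sigma> \<psi>s \<in> \<Delta>) \<and> list_all2 (\<in>) \<phi>s As)"
    using wff_App.prems iff by (auto simp: canonical_model_def)
  \<comment> \<open>From left to right, \<open>\<phi>s\<close> is itself one of the lists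
    \<open>\<psi>s\<close>; the converse is the existence of successors.\<close>
  also have "\<dots> \<longleftrightarrow> App ws t \<sigma> \<phi>s \<in> \<Delta>"
    using canonical_successors[OF wff_App.prems _ \<Gamma>] by metis
  finally show ?case .
next
  case (wff_At z u \<psi> t)
  \<comment> \<open>Evaluation jumps to the world \<open>named s \<Gamma> z\<close>, where the
    induction hypothesis holds because it covers all worlds of the sort of \<open>z\<close>.
    Agreement afterwards returns from \<open>\<Gamma>\<close> to \<open>\<Delta>\<close>.\<close>
  have "sat (canonical_model L s \<Gamma>) (canonical_assignment s \<Gamma>) \<Delta> (At t z \<psi>) \<longleftrightarrow>
      \<psi> \<in> named s \<Gamma> z"
    using wff_At.IH named_in_canonical_world[OF \<Gamma> wff_At.hyps(1)] by (simp add: Den_canonical)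
  also have "\<dots> \<longleftrightarrow> At t z \<psi> \<in> \<Delta>"
    using wff_At.prems wff_At.hyps by (auto simp: canonical_world_def At_agree_def named_def)
  finally show ?case .
qed

lemma is_model_canonical:
  assumes "mcs L s \<Gamma>"
  shows "is_model L (canonical_model L s \<Gamma>)"
proof -
  have "canonical_world L s \<Gamma> t \<noteq> {}" for t
    using At_agree_exists[OF assms] by (auto simp: canonical_world_def)
  moreover have "named s \<Gamma> (Nom t j) \<in> canonical_world L s \<Gamma> t" if "j \<in> Noms L t" for t j
    using that by (intro named_in_canonical_world[OF assms]) (simp add: state_symbols_def)
  ultimately show ?thesis by (auto simp: is_model_def canonical_model_def)
qed

lemma is_assignment_canonical:
  assumes "mcs L s \<Gamma>"
  shows "is_assignment L (canonical_model L s \<Gamma>) (canonical_assignment s \<Gamma>)"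
  using named_in_canonical_world[OF assms]
  by (simp add: is_assignment_def canonical_model_def canonical_assignment_def state_symbols_def)

theorem mainTheorem4:
  fixes L :: "('s, 'f, 'p, 'n, 'v) language"
    and s :: 's
    and \<Gamma> :: "('s, 'f, 'p, 'n, 'v) form set"
  assumes "hybrid_language L"
    and "\<forall>\<phi>\<in>\<Gamma>. wff L s \<phi>"
    and "consistent L s \<Gamma>"
  shows "\<exists>(M :: ('s, 'f, 'p, 'n, ('s, 'f, 'p, 'n, 'v) form set) model) g w.
           is_model L M \<and> is_assignment L M g \<and> w \<in> World M s \<and> (\<forall>\<phi>\<in>\<Gamma>. sat M g w \<phi>)"
proof -
  obtain \<Delta> where \<Delta>: "mcs L s \<Delta>" "\<Gamma> \<subseteq> \<Delta>" using lindenbaum[OF assms(2,3)] by blast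
  \<comment> \<open>The set that generates the model also serves as the point of evaluation, as it
    agrees with itself.\<close>
  have root: "\<Delta> \<in> canonical_world L s \<Delta> s"
    using \<Delta>(1) by (simp add: canonical_world_def At_agree_def)
  have "\<forall>\<phi>\<in>\<Gamma>. sat (canonical_model L s \<Delta>) (canonical_assignment s \<Delta>) \<Delta> \<phi>"
    using canonical_truth[OF \<Delta>(1) _ root] assms(2) \<Delta>(2) by blast
  moreover have "\<Delta> \<in> World (canonical_model L s \<Delta>) s"
    using root by (simp add: canonical_model_def)
  ultimately show ?thesis
    using is_model_canonical[OF \<Delta>(1)] is_assignment_canonical[OF \<Delta>(1)] by blast
qed

end
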